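(* Let $0<q<1$, let $0<c_{1}(q)<c_{2}(q)<c_{3}(q)<\dots$ be all positive zeros of $\mathcal{C}_{q}$, and put $c_{-k}(q)=-c_{k}(q)$ for $k\in\mathbb{N}$. The orthogonality relation $$-\sum_{k\in\mathbb{Z}\setminus\{0\}}\frac{\mathcal{C}_{q}(qc_{k}(q))}{c_{k}(q)\,\mathcal{C}_{q}'(c_{k}(q))}\,P_{n}\left(q^{1/2}c_{k}(q);q\right)P_{m}\left(q^{1/2}c_{k}(q);q\right)=\delta_{mn}$$ holds for all $m,n\in\mathbb{Z}_{+}=\{0,1,2,\dots\}$.
   Context: Here $0<q<1$ and fractional powers of $q$ are positive reals. $(a;q)_{n}=\prod_{k=0}^{n-1}(1-aq^{k})$. The polynomials $P_n(x;q)$ are determined by $P_{0}(x;q)=1$, $P_1(x;q)=x$ and $$q^{-(n-1)/2}P_{n-1}(x;q)+q^{-n/2}P_{n+1}(x;q)=xP_{n}(x;q),\quad n\ge1.$$ The $q$-cosine is the entire function $\mathcal{C}_{q}(z)=\sum_{n=0}^{\infty}\frac{(-1)^{n}q^{n^{2}}}{(q;q)_{2n}}z^{2n}$; it has infinitely many zeros, all of them real and simple. *)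

theory Defs
  imports "HOL-Analysis.Analysis" "HOL-Computational_Algebra.Polynomial"
begin

definition qpochhammer :: "real \<Rightarrow> real \<Rightarrow> nat \<Rightarrow> real" where
  "qpochhammer a q n = (\<Prod>k<n. 1 - a * q ^ k)"

definition qcos :: "real \<Rightarrow> complex \<Rightarrow> complex" where
  "qcos q z = (\<Sum>n. (-1) ^ n * of_real (q ^ (n\<^sup>2) / qpochhammer q q (2 * n)) * z ^ (2 * n))"

text \<open>
  The third equation is the three-term recurrence at index \<open>n + 1\<close>, solved for the polynomial of
  index \<open>n + 2\<close>; the recurrence itself is \<open>Pq_recurrence\<close> below.
\<close>
fun Pq :: "real \<Rightarrow> nat \<Rightarrow> real poly" where
  "Pq q 0 = 1"
| "Pq q (Suc 0) = [:0, 1:]"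
| "Pq q (Suc (Suc n)) = smult (q powr ((real n + 1) / 2))
     ([:0, 1:] * Pq q (Suc n) - smult (q powr (- (real n / 2))) (Pq q n))"

lemma Pq_recurrence:
  assumes "0 < q" and "n \<ge> 1"
  shows "q powr (- ((real n - 1) / 2)) * poly (Pq q (n - 1)) x
           + q powr (- (real n / 2)) * poly (Pq q (n + 1)) x = x * poly (Pq q n) x"
proof -
  obtain m where n: "n = Suc m"
    using assms(2) by (cases n) auto
  have "q powr (- (real n / 2)) * q powr ((real m + 1) / 2) = q powr 0"
    unfolding powr_add[symmetric] n by (simp add: field_simps)
  then have inv: "q powr (- (real n / 2)) * q powr ((real m + 1) / 2) = 1"
    using assms(1) by simp
  have "q powr (- (real n / 2)) * poly (Pq q (n + 1)) x
      = (q powr (- (real n / 2)) * q powr ((real m + 1) / 2))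
          * (x * poly (Pq q n) x - q powr (- (real m / 2)) * poly (Pq q m) x)"
    by (simp add: n)
  also have "\<dots> = x * poly (Pq q n) x - q powr (- (real m / 2)) * poly (Pq q m) x"
    unfolding inv by simp
  finally have "q powr (- (real n / 2)) * poly (Pq q (n + 1)) x
      = x * poly (Pq q n) x - q powr (- (real m / 2)) * poly (Pq q m) x" .
  moreover have "n - 1 = m" "real n - 1 = real m"
    by (simp_all add: n)
  ultimately show ?thesis
    by simp
qed

lemma qpochhammer_Suc: "qpochhammer a q (Suc n) = qpochhammer a q n * (1 - a * q ^ n)"
  by (simp add: qpochhammer_def)

lemma qpochhammer_pos:
  assumes "0 < q" "q < 1"
  shows "qpochhammer q q n > 0"
  unfolding qpochhammer_def
  by (intro prod_pos) (use assms power_less_one_iff[of q "Suc _"] in auto)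

lemma summable_qcos:
  fixes z :: complex
  assumes "0 < q" "q < 1"
  shows "summable (\<lambda>n. (-1) ^ n * of_real (q ^ (n\<^sup>2) / qpochhammer q q (2 * n)) * z ^ (2 * n))"
    (is "summable ?f")
proof -
  define b where "b n = q ^ (2 * n + 1) / ((1 - q * q ^ (2 * n)) * (1 - q * q ^ (2 * n + 1)))" for n
  have q2: "(\<lambda>n. q ^ (2 * n)) \<longlonglongrightarrow> 0"
    using LIMSEQ_realpow_zero[of "q\<^sup>2"] assms by (simp add: power_mult power_less_one_iff)
  have "b \<longlonglongrightarrow> 0 * q / ((1 - q * 0) * (1 - q * (0 * q)))"
    unfolding b_def power_add power_one_right by (intro tendsto_intros q2) auto
  then have "(\<lambda>n. b n * (cmod z)\<^sup>2) \<longlonglongrightarrow> 0 * (cmod z)\<^sup>2"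
    by (intro tendsto_intros) simp
  then have "eventually (\<lambda>n. b n * (cmod z)\<^sup>2 < 1 / 2) sequentially"
    by (rule order_tendstoD) simp
  then obtain N where N: "\<And>n. n \<ge> N \<Longrightarrow> b n * (cmod z)\<^sup>2 < 1 / 2"
    by (auto simp: eventually_sequentially)
  have abs_q: "\<bar>q\<bar> = q" using assms by simp
  show ?thesis
  proof (rule summable_ratio_test[of "1 / 2" N])
    fix n assume "N \<le> n"
    have 1: "\<bar>qpochhammer q q k\<bar> = qpochhammer q q k" for k
      using qpochhammer_pos[OF assms, of k] by simp
    have eq: "norm (?f k) = q ^ (k\<^sup>2) / qpochhammer q q (2 * k) * cmod z ^ (2 * k)" for k
      by (simp add: norm_mult norm_power norm_divide 1 abs_q)
    have e: "q ^ ((Suc n)\<^sup>2) = q ^ (n\<^sup>2) * q ^ (2 * n + 1)"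
      unfolding power_add[symmetric] by (rule arg_cong[where f = "(^) q"]) (simp add: power2_eq_square)
    have qp: "qpochhammer q q (2 * Suc n)
        = qpochhammer q q (2 * n) * ((1 - q * q ^ (2 * n)) * (1 - q * q ^ (2 * n + 1)))"
      by (simp add: qpochhammer_Suc)
    have "norm (?f (Suc n)) = b n * (cmod z)\<^sup>2 * norm (?f n)"
      unfolding eq unfolding b_def e qp by (simp add: power2_eq_square mult_ac)
    also have "\<dots> \<le> 1 / 2 * norm (?f n)"
      using N[OF \<open>N \<le> n\<close>] by (intro mult_right_mono) auto
    finally show "norm (?f (Suc n)) \<le> 1 / 2 * norm (?f n)" .
  qed simp
qed

end

theory Submission
  imports Defs "HOL-Complex_Analysis.Complex_Analysis"
begin

text \<open>
  Let \<open>C\<close> denote the q-cosine and put \<open>r = q\<^bsup>1/2\<^esup>\<close>. The polynomials \<open>P\<^sub>n(r z; q)\<close> are the solution, regular at index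
  \<open>0\<close>, of \<open>(J - z) g = 0\<close> for the Jacobi matrix \<open>J\<close> with zero diagonal and off-diagonal entries \<open>r\<^bsup>-n-1\<^esup>\<close>.
  The relation to be proved says that the zeros of \<open>C\<close> are the spectrum of a self-adjoint realization of \<open>J\<close> and that its
  eigenvectors are complete: the matrix with the entries \<open>w\<^sub>k\<^bsup>1/2\<^esup> P\<^sub>n(r c\<^sub>k; q)\<close>, where
  \<open>w\<^sub>k = - C(q c\<^sub>k) / (c\<^sub>k C'(c\<^sub>k))\<close>, has orthonormal columns.

  The q-difference equations of the q-cosine and the q-sine provide an explicit second solution \<open>Y\<^sub>n(z)\<close> that decays as \<open>n\<close>
  grows (\<open>jacobi_min\<close>), with \<open>Y\<^bsub>-1\<^esub> = - C\<close>. So \<open>C\<close> is, up to a power of \<open>r\<close>, the Wronskian of the two solutions; at a zero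
  of \<open>C\<close> the decaying solution is a multiple of the polynomials, and \<open>C(q c\<^sub>k) / c\<^sub>k\<close> is the factor \<open>Y\<^sub>0(c\<^sub>k)\<close>.
  The Green function \<open>P\<^bsub>min m n\<^esub> Y\<^bsub>max m n\<^esub> / C\<close> satisfies \<open>(J - z) h = e\<^sub>n\<close>.

  Instead of constructing an unbounded operator, the proof takes the imaginary part of \<open>\<langle>h, (J - z) h\<rangle>\<close>
  (\<open>jacobi_eq_energy\<close>). The boundary term vanishes because \<open>Y\<close> decays, and what remains is
  \<open>\<bar>Im z\<bar> * \<parallel>h\<parallel>\<^sup>2 \<le> \<bar>h\<^sub>n\<bar>\<close>, so all entries are at most \<open>1 / \<bar>Im z\<bar>\<close> (\<open>jacobi_green_le\<close>). This one
  inequality gives everything that is needed about the zeros: they are real (\<open>qcos_zero_real\<close>), and letting \<open>z\<close> approach a zero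
  vertically shows that it is simple and has positive weight \<open>w = - Y\<^sub>0 / C'\<close> (\<open>qcos_zero_slope\<close>).

  The same inequality replaces lower bounds for \<open>C\<close> on large circles. Row \<open>m\<close> of \<open>(J - z) h = e\<^sub>n\<close> shows that
  \<open>h\<^sub>m + \<delta>\<^bsub>mn\<^esub> / z\<close> is of order \<open>1 / (\<bar>z\<bar> \<bar>Im z\<bar>)\<close>. Multiplied by \<open>1 - z\<^sup>2 / R\<^sup>2\<close>, which on
  \<open>\<bar>z\<bar> = R\<close> has modulus \<open>2 \<bar>Im z\<bar> / R\<close>, it is \<open>O(1 / R\<^sup>2)\<close> on the whole circle, and the residue theorem gives
  \<open>\<Sum> w P\<^sub>m P\<^sub>n (1 - x\<^sup>2 / R\<^sup>2) = \<delta>\<^bsub>mn\<^esub> + O(1 / R)\<close>, summed over the zeros \<open>x\<close> in the disc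
  (\<open>riesz_mean_estimate\<close>). Since the weights are nonnegative, the factor \<open>1 - x\<^sup>2 / R\<^sup>2\<close> can be removed for sums of squares,
  and polarization yields the relation for all \<open>m\<close> and \<open>n\<close> (\<open>spectral_orthogonality\<close>).
\<close>

section \<open>The q-cosine and its companion q-sine series\<close>

text \<open>
  Both series are taken in the variable \<open>w = z\<^sup>2\<close>: the q-cosine is \<open>C(z) = qcos_ser q (z\<^sup>2)\<close>, and the q-sine, the odd
  companion of the q-cosine, is \<open>S(z) = z * qsin_ser q (z\<^sup>2)\<close>. In this variable both are ordinary power series.
\<close>

definition qcos_coeff :: "real \<Rightarrow> nat \<Rightarrow> complex" where
  "qcos_coeff q n = (-1) ^ n * of_real (q ^ (n\<^sup>2) / qpochhammer q q (2 * n))"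

definition qsin_coeff :: "real \<Rightarrow> nat \<Rightarrow> complex" where
  "qsin_coeff q n = (-1) ^ n * of_real (q ^ (n\<^sup>2 + n) / qpochhammer q q (2 * n + 1))"

definition qcos_ser :: "real \<Rightarrow> complex \<Rightarrow> complex" where
  "qcos_ser q w = (\<Sum>n. qcos_coeff q n * w ^ n)"

definition qsin_ser :: "real \<Rightarrow> complex \<Rightarrow> complex" where
  "qsin_ser q w = (\<Sum>n. qsin_coeff q n * w ^ n)"

lemma qcos_eq_qcos_ser: "qcos q z = qcos_ser q (z\<^sup>2)"
  by (simp add: qcos_def qcos_ser_def qcos_coeff_def power_mult)

context
  fixes q :: real
  assumes q0: "0 < q" and q1: "q < 1"
begin

lemma summable_qcos_ser: "summable (\<lambda>n. qcos_coeff q n * w ^ n)"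
  using summable_qcos[OF q0 q1, of "csqrt w"]
  by (simp add: qcos_coeff_def power_mult)

lemma summable_qsin_ser: "summable (\<lambda>n. qsin_coeff q n * w ^ n)"
proof (rule summable_comparison_test')
  \<comment> \<open>Comparison with the q-cosine series: the extra factors \<open>q\<^sup>n / (1 - q\<^bsup>2n+1\<^esup>)\<close> are at most \<open>1 / (1 - q)\<close>.\<close>
  have "summable (\<lambda>n. norm (qcos_coeff q n * w ^ n))"
    by (rule powser_insidea[OF summable_qcos_ser[of "of_real (norm w + 1)"]]) simp
  then show "summable (\<lambda>n. norm (qcos_coeff q n * w ^ n) * (1 / (1 - q)))"
    by (rule summable_mult2)
next
  fix n :: nat
  assume "n \<ge> 0"
  have pos: "qpochhammer q q k > 0" for k
    by (rule qpochhammer_pos[OF q0 q1])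
  have le1: "q ^ k \<le> 1" for k
    using q0 q1 by (simp add: power_le_one)
  have "q * q ^ (2 * n) \<le> q * 1"
    using q0 le1 by (intro mult_left_mono) auto
  then have "qpochhammer q q (2 * n) * (1 - q) \<le> qpochhammer q q (2 * n + 1)"
    using pos[of "2 * n"] by (simp add: qpochhammer_Suc)
  then have "q ^ (n\<^sup>2 + n) / qpochhammer q q (2 * n + 1)
      \<le> (q ^ (n\<^sup>2) * 1) / (qpochhammer q q (2 * n) * (1 - q))"
    unfolding power_add using q0 q1 pos[of "2 * n"] le1[of n]
    by (intro frac_le mult_mono) auto
  then have "norm (qsin_coeff q n) \<le> norm (qcos_coeff q n) * (1 / (1 - q))"
    using pos[of "2 * n"] pos[of "2 * n + 1"] q0
    by (simp add: qsin_coeff_def qcos_coeff_def norm_mult norm_power norm_divide)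
  then have "norm (qsin_coeff q n) * norm (w ^ n) \<le> (norm (qcos_coeff q n) * (1 / (1 - q))) * norm (w ^ n)"
    by (rule mult_right_mono) simp
  then show "norm (qsin_coeff q n * w ^ n) \<le> norm (qcos_coeff q n * w ^ n) * (1 / (1 - q))"
    by (simp add: norm_mult)
qed

lemma qcos_ser_holomorphic: "qcos_ser q holomorphic_on A"
proof -
  have "qcos_ser q field_differentiable at w within A" for w
    using termdiffs_strong_converges_everywhere[OF summable_qcos_ser, of w]
    unfolding qcos_ser_def[abs_def]
    by (meson field_differentiable_at_within field_differentiable_def)
  then show ?thesis by (simp add: holomorphic_on_def)
qed

lemma qsin_ser_holomorphic: "qsin_ser q holomorphic_on A"
proof -
  have "qsin_ser q field_differentiable at w within A" for w
    using termdiffs_strong_converges_everywhere[OF summable_qsin_ser, of w]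
    unfolding qsin_ser_def[abs_def]
    by (meson field_differentiable_at_within field_differentiable_def)
  then show ?thesis by (simp add: holomorphic_on_def)
qed

lemma qcos_ser_0: "qcos_ser q 0 = 1"
  unfolding qcos_ser_def powser_zero by (simp add: qcos_coeff_def qpochhammer_def)

lemma qcos_coeff_Suc: "qcos_coeff q (Suc n) * (1 - of_real q ^ (2 * n + 2)) = - (of_real q ^ Suc n) * qsin_coeff q n"
proof -
  have e: "q ^ ((Suc n)\<^sup>2) = q ^ (n\<^sup>2 + n) * q ^ Suc n"
    unfolding power_add[symmetric] by (rule arg_cong[where f = "(^) q"]) (simp add: power2_eq_square)
  have p: "qpochhammer q q (2 * Suc n) = qpochhammer q q (2 * n + 1) * (1 - q ^ (2 * n + 2))"
    by (simp add: qpochhammer_Suc)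
  have "1 - q ^ (2 * n + 2) \<noteq> 0"
    using power_less_one_iff[of q "2 * n + 2"] q0 q1 by auto
  then have eq: "q ^ ((Suc n)\<^sup>2) / qpochhammer q q (2 * Suc n) * (1 - q ^ (2 * n + 2))
      = q ^ Suc n * (q ^ (n\<^sup>2 + n) / qpochhammer q q (2 * n + 1))"
    unfolding e p by (simp add: mult.commute)
  have "qcos_coeff q (Suc n) * (1 - of_real q ^ (2 * n + 2))
      = (-1) ^ Suc n * of_real (q ^ ((Suc n)\<^sup>2) / qpochhammer q q (2 * Suc n) * (1 - q ^ (2 * n + 2)))"
    by (simp only: qcos_coeff_def of_real_mult of_real_diff of_real_power of_real_1 mult.assoc)
  also have "\<dots> = - (of_real q ^ Suc n) * qsin_coeff q n"
    unfolding eq of_real_mult qsin_coeff_def by (simp only: of_real_power of_real_mult power_Suc mult_ac mult_minus_left mult_minus_right mult_1)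
  finally show ?thesis .
qed

lemma qsin_coeff_eq: "qsin_coeff q n * (1 - of_real q ^ (2 * n + 1)) = qcos_coeff q n * of_real q ^ n"
proof -
  have p: "qpochhammer q q (2 * n + 1) = qpochhammer q q (2 * n) * (1 - q ^ (2 * n + 1))"
    by (simp add: qpochhammer_Suc)
  have "1 - q ^ (2 * n + 1) \<noteq> 0"
    using power_less_one_iff[of q "2 * n + 1"] q0 q1 by auto
  then have eq: "q ^ (n\<^sup>2 + n) / qpochhammer q q (2 * n + 1) * (1 - q ^ (2 * n + 1))
      = q ^ (n\<^sup>2) / qpochhammer q q (2 * n) * q ^ n"
    unfolding p power_add by simp
  have "qsin_coeff q n * (1 - of_real q ^ (2 * n + 1))
      = (-1) ^ n * of_real (q ^ (n\<^sup>2 + n) / qpochhammer q q (2 * n + 1) * (1 - q ^ (2 * n + 1)))"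
    by (simp only: qsin_coeff_def of_real_mult of_real_diff of_real_power of_real_1 mult.assoc)
  also have "\<dots> = qcos_coeff q n * of_real q ^ n"
    unfolding eq of_real_mult qcos_coeff_def by (simp only: of_real_power mult.assoc)
  finally show ?thesis .
qed

text \<open>
  In terms of \<open>C\<close> and \<open>S\<close> this and \<open>qsin_ser_shift\<close> are \<open>C(z) - C(qz) = - r z S(rz)\<close> and
  \<open>S(z) - S(qz) = z C(rz)\<close> with \<open>r\<^sup>2 = q\<close>. Values of \<open>C\<close> and \<open>S\<close> taken alternately along the geometric sequence
  \<open>z, rz, r\<^sup>2z, ...\<close> therefore satisfy a three-term recurrence.
\<close>

lemma qcos_ser_shift: "qcos_ser q w - qcos_ser q (of_real q ^ 2 * w) = - of_real q * w * qsin_ser q (of_real q * w)"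
proof -
  let ?f = "\<lambda>n. qcos_coeff q n * w ^ n - qcos_coeff q n * (of_real q ^ 2 * w) ^ n"
  have "?f sums (qcos_ser q w - qcos_ser q (of_real q ^ 2 * w))"
    unfolding qcos_ser_def by (intro sums_diff summable_sums summable_qcos_ser)
  then have 1: "(\<lambda>n. ?f (Suc n)) sums (qcos_ser q w - qcos_ser q (of_real q ^ 2 * w))"
    by (subst sums_Suc_iff) simp
  have "?f (Suc n) = (qcos_coeff q (Suc n) * (1 - of_real q ^ (2 * n + 2))) * w ^ Suc n" for n
    by (simp add: algebra_simps power_mult_distrib power_mult[symmetric] power2_eq_square mult_2 mult_2_right power_add)
  also have "\<dots> n = - of_real q * w * (qsin_coeff q n * (of_real q * w) ^ n)" for n
    unfolding qcos_coeff_Suc by (simp add: power_mult_distrib)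
  finally have 2: "?f (Suc n) = - of_real q * w * (qsin_coeff q n * (of_real q * w) ^ n)" for n .
  have "(\<lambda>n. ?f (Suc n)) sums (- of_real q * w * qsin_ser q (of_real q * w))"
    unfolding 2 qsin_ser_def by (intro sums_mult summable_sums summable_qsin_ser)
  then show ?thesis using 1 sums_unique2 by blast
qed

lemma qsin_ser_shift: "qsin_ser q w - of_real q * qsin_ser q (of_real q ^ 2 * w) = qcos_ser q (of_real q * w)"
proof -
  let ?f = "\<lambda>n. qsin_coeff q n * w ^ n - of_real q * (qsin_coeff q n * (of_real q ^ 2 * w) ^ n)"
  have 1: "?f sums (qsin_ser q w - of_real q * qsin_ser q (of_real q ^ 2 * w))"
    unfolding qsin_ser_def by (intro sums_diff sums_mult summable_sums summable_qsin_ser)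
  have "?f n = (qsin_coeff q n * (1 - of_real q ^ (2 * n + 1))) * w ^ n" for n
    by (simp add: algebra_simps power_mult_distrib power_mult[symmetric] power2_eq_square mult_2 mult_2_right power_add)
  then have 2: "?f n = qcos_coeff q n * (of_real q * w) ^ n" for n
    unfolding qsin_coeff_eq by (simp add: power_mult_distrib)
  have "?f sums qcos_ser q (of_real q * w)"
    unfolding 2 qcos_ser_def by (intro summable_sums summable_qcos_ser)
  then show ?thesis using 1 sums_unique2 by blast
qed

lemma qcos_ser_cnj: "qcos_ser q (cnj w) = cnj (qcos_ser q w)"
proof -
  have "(\<lambda>n. cnj (qcos_coeff q n * w ^ n)) sums cnj (qcos_ser q w)"
    unfolding qcos_ser_def sums_cnj by (intro summable_sums summable_qcos_ser)
  moreover have "cnj (qcos_coeff q n * w ^ n) = qcos_coeff q n * cnj w ^ n" for n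
    by (simp add: qcos_coeff_def)
  ultimately show ?thesis
    unfolding qcos_ser_def by (simp only: sums_iff)
qed

lemma qsin_ser_cnj: "qsin_ser q (cnj w) = cnj (qsin_ser q w)"
proof -
  have "(\<lambda>n. cnj (qsin_coeff q n * w ^ n)) sums cnj (qsin_ser q w)"
    unfolding qsin_ser_def sums_cnj by (intro summable_sums summable_qsin_ser)
  moreover have "cnj (qsin_coeff q n * w ^ n) = qsin_coeff q n * cnj w ^ n" for n
    by (simp add: qsin_coeff_def)
  ultimately show ?thesis
    unfolding qsin_ser_def by (simp only: sums_iff)
qed

end

section \<open>Solutions of the Jacobi equation and their energy\<close>

text \<open>
  With \<open>r\<^sup>2 = q\<close> this is \<open>P\<^sub>n(r z; q)\<close> continued to complex \<open>z\<close>, where the recurrence has only integral powers of \<open>r\<close>;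
  see \<open>jacobi_pol_of_real\<close>.
\<close>

fun jacobi_pol :: "real \<Rightarrow> nat \<Rightarrow> complex \<Rightarrow> complex" where
  "jacobi_pol r 0 z = 1"
| "jacobi_pol r (Suc 0) z = of_real r * z"
| "jacobi_pol r (Suc (Suc n)) z =
     of_real r ^ (n + 2) * z * jacobi_pol r (Suc n) z - of_real r * jacobi_pol r n z"

text \<open>
  With \<open>C\<close>, \<open>S\<close> as above, the entry of index \<open>2j\<close> is \<open>(-1)\<^sup>j r\<^bsup>j+1\<^esup> S(r\<^bsup>2j+1\<^esup> z)\<close> and the one of index \<open>2j+1\<close> is
  \<open>(-1)\<^sup>j r\<^bsup>j+1\<^esup> C(r\<^bsup>2j+2\<^esup> z)\<close>. The signs and powers of \<open>r\<close> make it a solution of the recurrence of \<open>jacobi_pol\<close>. It is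
  the minimal solution, i.e. the one that decays, and its entry of index \<open>-1\<close>, obtained by running the recurrence backwards,
  is \<open>- C(z)\<close>.
\<close>

definition jacobi_min :: "real \<Rightarrow> nat \<Rightarrow> complex \<Rightarrow> complex" where
  "jacobi_min r n z =
     (if even n then (-1) ^ (n div 2) * of_real r ^ (3 * (n div 2) + 2) * z
                       * qsin_ser (r\<^sup>2) (of_real r ^ (2 * (n + 1)) * z\<^sup>2)
      else (-1) ^ (n div 2) * of_real r ^ (n div 2 + 1)
                       * qcos_ser (r\<^sup>2) (of_real r ^ (2 * (n + 1)) * z\<^sup>2))"

text \<open>
  The equation \<open>(J - z) g = b e\<^sub>n\<close> for the Jacobi matrix \<open>J\<close> with zero diagonal and off-diagonal entries
  \<open>r\<^bsup>-m-1\<^esup>\<close>, \<open>m \<ge> 0\<close>, with its row \<open>m\<close> solved for \<open>g (m + 1)\<close>.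
\<close>

definition jacobi_eq :: "real \<Rightarrow> complex \<Rightarrow> nat \<Rightarrow> complex \<Rightarrow> (nat \<Rightarrow> complex) \<Rightarrow> bool" where
  "jacobi_eq r z n b g \<longleftrightarrow>
     g 1 = of_real r * z * g 0 + (if n = 0 then of_real r * b else 0) \<and>
     (\<forall>m. g (m + 2) = of_real r ^ (m + 2) * z * g (m + 1) - of_real r * g m
            + (if n = m + 1 then of_real r ^ (m + 2) * b else 0))"

text \<open>
  The classical product formula for a Green function: a solution satisfying the boundary condition at \<open>0\<close>, times one that decays,
  not yet divided by the Wronskian. Leaving out that division keeps all entries entire in \<open>z\<close>.
\<close>

definition jacobi_green :: "real \<Rightarrow> nat \<Rightarrow> complex \<Rightarrow> nat \<Rightarrow> complex" where
  "jacobi_green r n z m = jacobi_pol r (min m n) z * jacobi_min r (max m n) z"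

lemma jacobi_pol_holomorphic: "jacobi_pol r n holomorphic_on A"
proof (induction n rule: induct_nat_012)
  case (ge2 n)
  then show ?case by (auto intro!: holomorphic_intros)
qed (auto intro!: holomorphic_intros)

lemma jacobi_pol_of_real:
  assumes "0 < r"
  shows "jacobi_pol r n (of_real x) = of_real (poly (Pq (r\<^sup>2) n) (r * x))"
proof (induction n rule: induct_nat_012)
  case (ge2 n)
  have sq: "r\<^sup>2 = r powr 2"
    using assms by simp
  have 1: "(r\<^sup>2) powr ((real n + 1) / 2) = r ^ (n + 1)"
  proof -
    have "(r\<^sup>2) powr ((real n + 1) / 2) = r powr (real (n + 1))"
      unfolding sq powr_powr by (rule arg_cong[where f = "(powr) r"]) simp
    then show ?thesis
      by (simp only: powr_realpow[OF assms])
  qed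
  have 2: "(r\<^sup>2) powr (- (real n / 2)) = inverse (r ^ n)"
  proof -
    have "(r\<^sup>2) powr (- (real n / 2)) = r powr (- real n)"
      unfolding sq powr_powr by (rule arg_cong[where f = "(powr) r"]) simp
    then show ?thesis
      by (simp only: powr_minus powr_realpow[OF assms])
  qed
  have "poly (Pq (r\<^sup>2) (Suc (Suc n))) (r * x)
      = r ^ (n + 2) * x * poly (Pq (r\<^sup>2) (Suc n)) (r * x) - r * poly (Pq (r\<^sup>2) n) (r * x)"
    unfolding Pq.simps 1 2 using assms by (simp add: field_simps)
  then show ?case by (simp add: ge2)
qed auto

lemma cmod_square: "(complex_of_real (cmod w))\<^sup>2 = w * cnj w"
  using complex_norm_square[of w] by simp

text \<open>
  The imaginary part of \<open>\<langle>g, (J - z) g\<rangle> = b * cnj (g n)\<close>, truncated at \<open>M\<close>: since \<open>J\<close> is real and symmetric, all inner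
  off-diagonal terms drop out and only the flux through the cut between \<open>M\<close> and \<open>M + 1\<close> remains.
\<close>

lemma jacobi_eq_energy:
  assumes r: "0 < r" and g: "jacobi_eq r z n b g"
  shows "Im z * (\<Sum>m\<le>M. (cmod (g m))\<^sup>2) + (if n \<le> M then Im (cnj (g n) * b) else 0)
           = Im (cnj (g M) * g (Suc M)) / r ^ Suc M"
proof (induction M)
  case 0
  have "g (Suc 0) = of_real r * z * g 0 + (if n = 0 then of_real r * b else 0)"
    using g by (simp add: jacobi_eq_def)
  then have "cnj (g 0) * g (Suc 0)
      = of_real r * (z * of_real ((cmod (g 0))\<^sup>2) + (if n = 0 then cnj (g 0) * b else 0))"
    by (simp add: cmod_square algebra_simps)
  then show ?case using r by (simp add: Im_complex_of_real)
next
  case (Suc M)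
  have gs: "g (Suc (Suc M)) = of_real r ^ (M + 2) * z * g (Suc M) - of_real r * g M
            + (if n = Suc M then of_real r ^ (M + 2) * b else 0)"
    using g by (simp add: jacobi_eq_def)
  have "cnj (g (Suc M)) * g (Suc (Suc M))
      = of_real (r ^ (M + 2)) * (z * of_real ((cmod (g (Suc M)))\<^sup>2)
          + (if n = Suc M then cnj (g (Suc M)) * b else 0))
        - of_real r * cnj (cnj (g M) * g (Suc M))"
    unfolding gs by (simp add: cmod_square algebra_simps)
  moreover have "Im (of_real a * w) = a * Im w" "Im (w * of_real a) = Im w * a" for a w
    by simp_all
  ultimately have "Im (cnj (g (Suc M)) * g (Suc (Suc M)))
      = r ^ (M + 2) * (Im z * (cmod (g (Suc M)))\<^sup>2
          + (if n = Suc M then Im (cnj (g (Suc M)) * b) else 0))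
        + r * Im (cnj (g M) * g (Suc M))"
    by (simp only: minus_complex.sel plus_complex.sel cnj.sel zero_complex.sel if_distrib[of Im]
        mult_minus_right diff_minus_eq_add)
  moreover have "X = r ^ (M + 2) * A + r * Y \<Longrightarrow> X / r ^ Suc (Suc M) = A + Y / r ^ Suc M" for X Y A
    using r by (simp add: field_simps)
  ultimately have "Im (cnj (g (Suc M)) * g (Suc (Suc M))) / r ^ Suc (Suc M)
      = Im z * (cmod (g (Suc M)))\<^sup>2
          + (if n = Suc M then Im (cnj (g (Suc M)) * b) else 0)
        + Im (cnj (g M) * g (Suc M)) / r ^ Suc M"
    by blast
  also have "\<dots> = Im z * (\<Sum>m\<le>Suc M. (cmod (g m))\<^sup>2) + (if n \<le> Suc M then Im (cnj (g n) * b) else 0)"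
    unfolding Suc.IH[symmetric] by (auto simp: algebra_simps)
  finally show ?case by simp
qed

text \<open>
  For a solution without flux at infinity the energy identity gives \<open>Im z * \<parallel>g\<parallel>\<^sup>2 = - Im (cnj (g n) * b)\<close>. This is the
  resolvent bound of a self-adjoint operator, obtained without constructing the operator.
\<close>

lemma jacobi_eq_bound:
  assumes r: "0 < r" and g: "jacobi_eq r z n b g"
    and lim: "(\<lambda>M. g M * g (Suc M) / of_real r ^ Suc M) \<longlonglongrightarrow> 0"
  shows "\<bar>Im z\<bar> * (cmod (g m))\<^sup>2 \<le> \<bar>Im (cnj (g n) * b)\<bar>" (is ?A)
    and "0 < Im z \<Longrightarrow> Im (cnj (g n) * b) \<le> 0" (is "_ \<Longrightarrow> ?B")
proof -
  let ?S = "\<lambda>M. \<Sum>m\<le>M. (cmod (g m))\<^sup>2"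
  have "(\<lambda>M. Im (cnj (g M) * g (Suc M)) / r ^ Suc M) \<longlonglongrightarrow> 0"
  proof (rule Lim_null_comparison)
    show "(\<lambda>M. norm (g M * g (Suc M) / of_real r ^ Suc M)) \<longlonglongrightarrow> 0"
      using lim by (rule tendsto_norm_zero)
    have "\<bar>Im (cnj (g M) * g (Suc M))\<bar> \<le> cmod (g M) * cmod (g (Suc M))" for M
      using abs_Im_le_cmod[of "cnj (g M) * g (Suc M)"] by (simp add: norm_mult)
    then show "\<forall>\<^sub>F M in sequentially. norm (Im (cnj (g M) * g (Suc M)) / r ^ Suc M)
        \<le> norm (g M * g (Suc M) / of_real r ^ Suc M)"
      using r by (intro always_eventually allI)
        (simp add: norm_mult norm_divide norm_power divide_right_mono del: power_Suc)
  qed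
  then have "(\<lambda>M. Im (cnj (g M) * g (Suc M)) / r ^ Suc M - Im (cnj (g n) * b))
      \<longlonglongrightarrow> 0 - Im (cnj (g n) * b)"
    by (intro tendsto_intros)
  moreover have "\<forall>\<^sub>F M in sequentially. Im (cnj (g M) * g (Suc M)) / r ^ Suc M - Im (cnj (g n) * b)
      = Im z * ?S M"
  proof (rule eventually_sequentiallyI[of n])
    fix M assume "n \<le> M"
    show "Im (cnj (g M) * g (Suc M)) / r ^ Suc M - Im (cnj (g n) * b) = Im z * ?S M"
      using jacobi_eq_energy[OF r g, of M] unfolding if_P[OF \<open>n \<le> M\<close>] by linarith
  qed
  ultimately have l: "(\<lambda>M. Im z * ?S M) \<longlonglongrightarrow> - Im (cnj (g n) * b)"
    by (simp add: tendsto_cong)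
  then have "(\<lambda>M. \<bar>Im z * ?S M\<bar>) \<longlonglongrightarrow> \<bar>- Im (cnj (g n) * b)\<bar>"
    by (rule tendsto_rabs)
  moreover have "\<bar>Im z\<bar> * (cmod (g m))\<^sup>2 \<le> \<bar>Im z * ?S M\<bar>" if "m \<le> M" for M
  proof -
    have "(cmod (g m))\<^sup>2 \<le> ?S M"
      using that by (intro member_le_sum) auto
    then have "\<bar>Im z\<bar> * (cmod (g m))\<^sup>2 \<le> \<bar>Im z\<bar> * ?S M"
      by (intro mult_left_mono) auto
    also have "\<dots> = \<bar>Im z * ?S M\<bar>"
      by (simp add: abs_mult sum_nonneg)
    finally show ?thesis .
  qed
  ultimately have "\<bar>Im z\<bar> * (cmod (g m))\<^sup>2 \<le> \<bar>- Im (cnj (g n) * b)\<bar>"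
    by (intro LIMSEQ_le_const) auto
  then show ?A by simp
  assume "0 < Im z"
  then have "0 \<le> - Im (cnj (g n) * b)"
    by (intro LIMSEQ_le_const[OF l] exI[of _ 0] allI impI mult_nonneg_nonneg sum_nonneg) auto
  then show ?B by simp
qed

section \<open>Quotients near a simple zero and weighted partial sums\<close>

lemma DERIV_seq_quotient:
  assumes "(f has_field_derivative D) (at z)" and "h \<longlonglongrightarrow> 0" and "\<And>N. h N \<noteq> 0"
  shows "(\<lambda>N. (f (z + h N) - f z) / h N) \<longlonglongrightarrow> D"
proof (rule filterlim_compose[where g = "\<lambda>k. (f (z + k) - f z) / k"])
  show "(\<lambda>k. (f (z + k) - f z) / k) \<midarrow>0\<rightarrow> D"
    using assms(1) by (simp add: DERIV_def)
  show "filterlim h (at 0) sequentially"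
    using assms(2,3) by (intro filterlim_atI) auto
qed

text \<open>
  The numerator is allowed to vanish at \<open>z\<close>; this matters because the polynomials \<open>P\<^sub>n\<close> may vanish at points of the spectrum.
\<close>

lemma residue_quotient_simple_zero:
  assumes "open s" "z \<in> s" "(\<lambda>w. f w / g w) holomorphic_on (s - {z})"
    and "isCont f z" and g: "(g has_field_derivative g') (at z)" "g z = 0" "g' \<noteq> 0"
  shows "residue (\<lambda>w. f w / g w) z = f z / g'"
proof (rule residue_simple'[OF assms(1-3)])
  have "((\<lambda>w. f w / ((g w - g z) / (w - z))) \<longlongrightarrow> f z / g') (at z)"
    using assms(4) g(1,3) unfolding isCont_def has_field_derivative_iff by (intro tendsto_divide) auto
  then show "((\<lambda>w. f w / g w * (w - z)) \<longlongrightarrow> f z / g') (at z)"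
    using g(2) by simp
qed

text \<open>
  For nonnegative terms the factor \<open>1 - x\<^sup>2 / R\<^sup>2\<close> is harmless: it lies between \<open>0\<close> and \<open>1\<close> and tends to \<open>1\<close> at each
  fixed \<open>x\<close>, so both summability and the value of the sum can be read off from the weighted partial sums. The factor
  itself serves to keep the contour integrals bounded near the real axis.
\<close>

lemma nonneg_has_sum_riesz_means:
  fixes a :: "real \<Rightarrow> real"
  assumes nonneg: "\<And>x. x \<in> Z \<Longrightarrow> 0 \<le> a x"
    and fin: "\<And>R. finite {x \<in> Z. \<bar>x\<bar> < R}"
    and R: "filterlim R at_top sequentially"
    and lim: "(\<lambda>N. \<Sum>x | x \<in> Z \<and> \<bar>x\<bar> < R N. a x * (1 - x\<^sup>2 / (R N)\<^sup>2)) \<longlonglongrightarrow> L"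
  shows "(a has_sum L) Z"
proof -
  let ?S = "\<lambda>N. \<Sum>x | x \<in> Z \<and> \<bar>x\<bar> < R N. a x * (1 - x\<^sup>2 / (R N)\<^sup>2)"
  have factor: "0 \<le> 1 - x\<^sup>2 / T\<^sup>2" "1 - x\<^sup>2 / T\<^sup>2 \<le> 1" if "\<bar>x\<bar> < T" for x T :: real
    using that abs_le_square_iff[of x T] by (auto simp: divide_le_eq_1)
  have fin_le: "sum a F \<le> L" if F: "finite F" "F \<subseteq> Z" for F
  proof (rule LIMSEQ_le)
    have "(\<lambda>N. x\<^sup>2 / (R N)\<^sup>2) \<longlonglongrightarrow> 0" for x
      by (intro tendsto_divide_0[OF tendsto_const] filterlim_at_top_imp_at_infinity
          filterlim_pow_at_top R) auto
    then have "(\<lambda>N. \<Sum>x\<in>F. a x * (1 - x\<^sup>2 / (R N)\<^sup>2)) \<longlonglongrightarrow> (\<Sum>x\<in>F. a x * (1 - 0))"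
      by (intro tendsto_intros)
    then show "(\<lambda>N. \<Sum>x\<in>F. a x * (1 - x\<^sup>2 / (R N)\<^sup>2)) \<longlonglongrightarrow> sum a F"
      by simp
    show "?S \<longlonglongrightarrow> L" by (rule lim)
    have "\<forall>\<^sub>F N in sequentially. \<forall>x\<in>F. \<bar>x\<bar> < R N"
      using F(1) R by (simp add: eventually_ball_finite_distrib filterlim_at_top_dense)
    then obtain N0 where N0: "\<And>N x. N \<ge> N0 \<Longrightarrow> x \<in> F \<Longrightarrow> \<bar>x\<bar> < R N"
      unfolding eventually_sequentially by blast
    have "(\<Sum>x\<in>F. a x * (1 - x\<^sup>2 / (R N)\<^sup>2)) \<le> ?S N" if "N \<ge> N0" for N
      using fin[of "R N"] F(2) N0[OF that] nonneg factor
      by (intro sum_mono2) (auto intro!: mult_nonneg_nonneg)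
    then show "\<exists>N0. \<forall>N\<ge>N0. (\<Sum>x\<in>F. a x * (1 - x\<^sup>2 / (R N)\<^sup>2)) \<le> ?S N"
      by blast
  qed
  have sm: "a summable_on Z"
    by (rule nonneg_bdd_above_summable_on) (use nonneg fin_le in \<open>auto intro!: bdd_aboveI\<close>)
  have "?S N \<le> infsum a Z" for N
  proof -
    have "?S N \<le> (\<Sum>x | x \<in> Z \<and> \<bar>x\<bar> < R N. a x)"
      using nonneg factor(2)[of _ "R N"] by (intro sum_mono) (auto intro!: mult_left_le)
    also have "\<dots> \<le> infsum a Z"
      using sm fin[of "R N"] nonneg by (intro finite_sum_le_infsum) auto
    finally show ?thesis .
  qed
  then have "L \<le> infsum a Z"
    by (intro LIMSEQ_le_const2[OF lim]) blast
  moreover have "infsum a Z \<le> L"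
    by (rule infsum_le_finite_sums[OF sm fin_le])
  ultimately show ?thesis
    using has_sum_infsum[OF sm] by simp
qed

text \<open>
  Up to its sign, the residue of \<open>jacobi_min r 0 / qcos\<close> at a zero \<open>x\<close>. It is the mass at \<open>x\<close> of the orthogonality
  measure. The residue is real; taking the real part only makes the weight a real number by definition.
\<close>

definition spectral_weight :: "real \<Rightarrow> real \<Rightarrow> real" where
  "spectral_weight r x = - Re (jacobi_min r 0 (of_real x) / deriv (qcos (r\<^sup>2)) (of_real x))"

section \<open>The decaying solution and the Green function\<close>

context
  fixes r :: real
  assumes r0: "0 < r" and r1: "r < 1"
begin

lemma r_square_bounds: "0 < r\<^sup>2" "r\<^sup>2 < 1"
  using r0 r1 by (auto simp: power_less_one_iff)

lemma jacobi_min_holomorphic: "jacobi_min r n holomorphic_on A"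
proof -
  have "(\<lambda>z. qsin_ser (r\<^sup>2) (of_real r ^ (2 * (n + 1)) * z\<^sup>2)) holomorphic_on A"
    by (rule holomorphic_on_compose[of "\<lambda>z. of_real r ^ (2 * (n + 1)) * z\<^sup>2" A, OF _ qsin_ser_holomorphic[OF r_square_bounds], unfolded o_def])
      (intro holomorphic_intros)
  moreover have "(\<lambda>z. qcos_ser (r\<^sup>2) (of_real r ^ (2 * (n + 1)) * z\<^sup>2)) holomorphic_on A"
    by (rule holomorphic_on_compose[of "\<lambda>z. of_real r ^ (2 * (n + 1)) * z\<^sup>2" A, OF _ qcos_ser_holomorphic[OF r_square_bounds], unfolded o_def])
      (intro holomorphic_intros)
  ultimately show ?thesis
    unfolding jacobi_min_def[abs_def] by (cases "even n") (auto intro!: holomorphic_intros)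
qed

lemma jacobi_min_cnj: "jacobi_min r n (cnj z) = cnj (jacobi_min r n z)"
  by (simp add: jacobi_min_def flip: qcos_ser_cnj[OF r_square_bounds] qsin_ser_cnj[OF r_square_bounds])

lemma jacobi_min_0: "z * jacobi_min r 0 z = qcos (r\<^sup>2) (of_real (r\<^sup>2) * z) - qcos (r\<^sup>2) z"
  using qcos_ser_shift[OF r_square_bounds, of "z\<^sup>2"]
  by (simp add: jacobi_min_def qcos_eq_qcos_ser power2_eq_square algebra_simps)

lemma jacobi_min_1: "jacobi_min r 1 z = of_real r * z * jacobi_min r 0 z + of_real r * qcos (r\<^sup>2) z"
proof -
  have "jacobi_min r 1 z = of_real r * qcos (r\<^sup>2) (of_real (r\<^sup>2) * z)"
    by (simp add: jacobi_min_def qcos_eq_qcos_ser power_mult_distrib power_mult[symmetric])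
  also have "qcos (r\<^sup>2) (of_real (r\<^sup>2) * z) = z * jacobi_min r 0 z + qcos (r\<^sup>2) z"
    by (simp add: jacobi_min_0)
  finally show ?thesis by (simp add: algebra_simps)
qed

text \<open>
  For even and odd \<open>n\<close> this is one of the two shift relations, applied at \<open>w = r\<^bsup>2n+2\<^esup> z\<^sup>2\<close>.
\<close>

lemma jacobi_min_rec:
  "jacobi_min r (n + 2) z = of_real r ^ (n + 2) * z * jacobi_min r (n + 1) z - of_real r * jacobi_min r n z"
proof (cases "even n")
  case True
  then obtain j where n: "n = 2 * j" by (auto elim!: evenE)
  define R A where "R = complex_of_real r" and "A = R ^ j"
  have p: "R ^ (3 * j + k) = A ^ 3 * R ^ k" "R ^ (2 * j + k) = A ^ 2 * R ^ k" "R ^ (j + k) = A * R ^ k"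
    "R ^ (3 * Suc j + k) = A ^ 3 * R ^ (k + 3)" for k
    by (simp_all add: A_def power_add power_mult[symmetric] mult.commute[of j])
  define w where "w = R ^ (2 * (n + 1)) * z\<^sup>2"
  have w1: "R ^ (2 * (Suc n + 1)) * z\<^sup>2 = of_real (r\<^sup>2) * w"
   and w2: "R ^ (2 * (Suc (Suc n) + 1)) * z\<^sup>2 = (of_real (r\<^sup>2))\<^sup>2 * w"
    by (simp_all add: w_def R_def power2_eq_square)
  have s: "qsin_ser (r\<^sup>2) w = R\<^sup>2 * qsin_ser (r\<^sup>2) ((of_real (r\<^sup>2))\<^sup>2 * w) + qcos_ser (r\<^sup>2) (of_real (r\<^sup>2) * w)"
    using qsin_ser_shift[OF r_square_bounds, of w] by (simp add: R_def algebra_simps)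
  have Y0: "jacobi_min r n z = (-1) ^ j * R ^ (3 * j + 2) * z * qsin_ser (r\<^sup>2) w"
    by (simp add: jacobi_min_def n w_def R_def)
  have Y1: "jacobi_min r (n + 1) z = (-1) ^ j * R ^ (j + 1) * qcos_ser (r\<^sup>2) (of_real (r\<^sup>2) * w)"
    unfolding w1[symmetric] by (simp add: jacobi_min_def n R_def)
  have Y2: "jacobi_min r (n + 2) z = - ((-1) ^ j) * R ^ (3 * Suc j + 2) * z * qsin_ser (r\<^sup>2) ((of_real (r\<^sup>2))\<^sup>2 * w)"
    unfolding w2[symmetric] by (simp add: jacobi_min_def n R_def)
  have pn: "R ^ (n + 2) = A ^ 2 * R ^ 2" using p(2)[of 2] n by simp
  show ?thesis
    unfolding Y0 Y1 Y2 s p R_def[symmetric] pn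
    by (simp add: algebra_simps power2_eq_square power3_eq_cube numeral_eq_Suc)
next
  case False
  then obtain j where n: "n = 2 * j + 1" by (auto elim!: oddE)
  define R A where "R = complex_of_real r" and "A = R ^ j"
  have p: "R ^ (3 * j + k) = A ^ 3 * R ^ k" "R ^ (2 * j + k) = A ^ 2 * R ^ k" "R ^ (j + k) = A * R ^ k"
    "R ^ (3 * Suc j + k) = A ^ 3 * R ^ (k + 3)" "R ^ (Suc j + k) = A * R ^ (k + 1)" for k
    by (simp_all add: A_def power_add power_mult[symmetric] mult.commute[of j])
  define w where "w = R ^ (2 * (n + 1)) * z\<^sup>2"
  have w1: "R ^ (2 * (Suc n + 1)) * z\<^sup>2 = of_real (r\<^sup>2) * w"
   and w2: "R ^ (2 * (Suc (Suc n) + 1)) * z\<^sup>2 = (of_real (r\<^sup>2))\<^sup>2 * w"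
    by (simp_all add: w_def R_def power2_eq_square)
  have w: "w = A ^ 4 * R ^ 4 * z\<^sup>2"
  proof -
    have "2 * (n + 1) = j * 4 + 4" using n by simp
    then show ?thesis by (simp only: w_def A_def power_add power_mult)
  qed
  have s: "qcos_ser (r\<^sup>2) w = qcos_ser (r\<^sup>2) ((of_real (r\<^sup>2))\<^sup>2 * w) - R\<^sup>2 * (A ^ 4 * R ^ 4 * z\<^sup>2) * qsin_ser (r\<^sup>2) (of_real (r\<^sup>2) * w)"
    using qcos_ser_shift[OF r_square_bounds, of w] unfolding w[symmetric] by (simp add: R_def algebra_simps)
  have Y0: "jacobi_min r n z = (-1) ^ j * R ^ (j + 1) * qcos_ser (r\<^sup>2) w"
    by (simp add: jacobi_min_def n w_def R_def)
  have Y1: "jacobi_min r (n + 1) z = - ((-1) ^ j) * R ^ (3 * Suc j + 2) * z * qsin_ser (r\<^sup>2) (of_real (r\<^sup>2) * w)"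
    unfolding w1[symmetric] by (simp add: jacobi_min_def n R_def)
  have Y2: "jacobi_min r (n + 2) z = - ((-1) ^ j) * R ^ (Suc j + 1) * qcos_ser (r\<^sup>2) ((of_real (r\<^sup>2))\<^sup>2 * w)"
    unfolding w2[symmetric] by (simp add: jacobi_min_def n R_def)
  have pn: "R ^ (n + 2) = A ^ 2 * R ^ 3"
  proof -
    have "n + 2 = 2 * j + 3" using n by simp
    then show ?thesis by (simp only: p)
  qed
  show ?thesis
    unfolding Y0 Y1 Y2 s p R_def[symmetric] pn
    by (simp add: algebra_simps power2_eq_square power3_eq_cube numeral_eq_Suc)
qed

text \<open>
  The starting value is where the q-cosine comes in: the backward value \<open>- qcos z\<close> of the decaying solution at index \<open>-1\<close> is the
  obstruction to its being a multiple of \<open>jacobi_pol\<close>.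
\<close>

lemma jacobi_wronskian:
  "jacobi_pol r n z * jacobi_min r (Suc n) z - jacobi_pol r (Suc n) z * jacobi_min r n z
     = of_real r ^ Suc n * qcos (r\<^sup>2) z"
proof (induction n)
  case 0
  then show ?case using jacobi_min_1[of z] by simp
next
  case (Suc n)
  have "jacobi_min r (Suc (Suc n)) z
      = of_real r ^ (n + 2) * z * jacobi_min r (Suc n) z - of_real r * jacobi_min r n z"
    using jacobi_min_rec[of n z] by simp
  then have "jacobi_pol r (Suc n) z * jacobi_min r (Suc (Suc n)) z - jacobi_pol r (Suc (Suc n)) z * jacobi_min r (Suc n) z
    = of_real r * (jacobi_pol r n z * jacobi_min r (Suc n) z - jacobi_pol r (Suc n) z * jacobi_min r n z)"
    by (simp only: jacobi_pol.simps) (simp add: algebra_simps)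
  then show ?case unfolding Suc.IH by simp
qed

text \<open>
  Both factors solve the homogeneous recurrence, and the kink at \<open>m = n\<close> contributes the Wronskian.
\<close>

lemma jacobi_green_eq: "jacobi_eq r z n (qcos (r\<^sup>2) z) (jacobi_green r n z)"
proof -
  have W: "jacobi_pol r n z * jacobi_min r (Suc n) z
      = jacobi_pol r (Suc n) z * jacobi_min r n z + of_real r ^ Suc n * qcos (r\<^sup>2) z" for n
    using jacobi_wronskian[of n z] by (simp add: algebra_simps)
  show ?thesis
    unfolding jacobi_eq_def
  proof (intro conjI allI)
    show "jacobi_green r n z 1 = of_real r * z * jacobi_green r n z 0
        + (if n = 0 then of_real r * qcos (r\<^sup>2) z else 0)"
    proof (cases "n = 0")
      case True
      then show ?thesis using jacobi_min_1[of z] by (simp add: jacobi_green_def)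
    next
      case False
      then have "min 1 n = Suc 0" "max 1 n = n" by auto
      with False show ?thesis by (simp add: jacobi_green_def)
    qed
  next
    fix m
    consider "m + 1 < n" | "n = m + 1" | "n \<le> m" by linarith
    then show "jacobi_green r n z (m + 2) = of_real r ^ (m + 2) * z * jacobi_green r n z (m + 1)
        - of_real r * jacobi_green r n z m
        + (if n = m + 1 then of_real r ^ (m + 2) * qcos (r\<^sup>2) z else 0)"
    proof cases
      case 1
      then have "min (m + 2) n = Suc (Suc m)" "max (m + 2) n = n" "min (m + 1) n = Suc m"
        "max (m + 1) n = n" "min m n = m" "max m n = n"
        by auto
      with 1 show ?thesis by (simp add: jacobi_green_def algebra_simps)
    next
      case 2
      then have "min (m + 2) n = Suc m" "max (m + 2) n = Suc (Suc m)" "min (m + 1) n = Suc m"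
        "max (m + 1) n = Suc m" "min m n = m" "max m n = Suc m"
        by auto
      with 2 W[of "Suc m"] show ?thesis by (simp add: jacobi_green_def algebra_simps)
    next
      case 3
      then have "min (m + 2) n = n" "max (m + 2) n = m + 2" "min (m + 1) n = n"
        "max (m + 1) n = m + 1" "min m n = n" "max m n = m"
        by auto
      with 3 show ?thesis
        by (simp add: jacobi_green_def jacobi_min_rec[of m z, simplified] algebra_simps)
    qed
  qed
qed

text \<open>
  Entries of even index are of order \<open>r\<^bsup>3n/2\<^esup>\<close> and those of odd index of order \<open>r\<^bsup>n/2\<^esup>\<close>. The
  product of two neighbours decays like \<open>r\<^bsup>2n\<^esup>\<close>, faster than the matrix entries grow; the square of an entry of odd
  index would not.
\<close>

lemma jacobi_min_bound: "\<exists>K. \<forall>n. cmod (jacobi_min r n z * jacobi_min r (Suc n) z) \<le> K * r ^ (2 * n)"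
proof -
  let ?B = "cball 0 ((cmod z)\<^sup>2) :: complex set"
  have bdd: "bounded (qcos_ser (r\<^sup>2) ` ?B)" "bounded (qsin_ser (r\<^sup>2) ` ?B)"
    by (intro compact_imp_bounded compact_continuous_image holomorphic_on_imp_continuous_on
        qcos_ser_holomorphic[OF r_square_bounds] qsin_ser_holomorphic[OF r_square_bounds] compact_cball)+
  obtain K1 where C: "\<And>w. w \<in> ?B \<Longrightarrow> cmod (qcos_ser (r\<^sup>2) w) \<le> K1"
    using bdd(1) unfolding bounded_iff by blast
  obtain K2 where S: "\<And>w. w \<in> ?B \<Longrightarrow> cmod (qsin_ser (r\<^sup>2) w) \<le> K2"
    using bdd(2) unfolding bounded_iff by blast
  have K1: "K1 \<ge> 0" and K2: "K2 \<ge> 0"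
    using order_trans[OF norm_ge_zero C[of 0]] order_trans[OF norm_ge_zero S[of 0]] by simp_all
  have in_B: "of_real r ^ k * z\<^sup>2 \<in> ?B" for k
    using r0 r1 by (simp add: norm_mult norm_power mult_left_le_one_le power_le_one)
  have even: "cmod (jacobi_min r (2 * j) z) \<le> K2 * cmod z * r ^ (3 * j)" for j
  proof -
    have "r ^ (3 * j + 2) \<le> r ^ (3 * j)"
      using r0 r1 by (intro power_decreasing) auto
    then have "r ^ (3 * j + 2) * (cmod z * cmod (qsin_ser (r\<^sup>2) (of_real r ^ (2 * (2 * j + 1)) * z\<^sup>2)))
        \<le> r ^ (3 * j) * (cmod z * K2)"
      using r0 by (intro mult_mono C S in_B) auto
    then show ?thesis using r0
      by (simp add: jacobi_min_def norm_mult norm_power mult_ac)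
  qed
  have odd: "cmod (jacobi_min r (2 * j + 1) z) \<le> K1 * r ^ j" for j
  proof -
    have "r ^ (j + 1) \<le> r ^ j"
      using r0 r1 by (intro power_decreasing) auto
    then have "r ^ (j + 1) * cmod (qcos_ser (r\<^sup>2) (of_real r ^ (2 * (2 * j + 1 + 1)) * z\<^sup>2))
        \<le> r ^ j * K1"
      using r0 by (intro mult_mono C S in_B) auto
    then show ?thesis using r0
      by (simp add: jacobi_min_def norm_mult norm_power mult_ac)
  qed
  have "cmod (jacobi_min r n z * jacobi_min r (Suc n) z) \<le> (K1 * K2 * cmod z) * r ^ (2 * n)" for n
  proof (cases "even n")
    case True
    then obtain j where n: "n = 2 * j" by (auto elim!: evenE)
    have "cmod (jacobi_min r n z * jacobi_min r (Suc n) z) \<le> (K2 * cmod z * r ^ (3 * j)) * (K1 * r ^ j)"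
      unfolding norm_mult using even[of j] odd[of j] n K2 r0 by (intro mult_mono) auto
    also have "\<dots> = (K1 * K2 * cmod z) * (r ^ (3 * j) * r ^ j)" by simp
    also have "r ^ (3 * j) * r ^ j = r ^ (2 * n)" by (simp add: n flip: power_add)
    finally show ?thesis .
  next
    case False
    then obtain j where n: "n = 2 * j + 1" by (auto elim!: oddE)
    have "cmod (jacobi_min r n z * jacobi_min r (Suc n) z) \<le> (K1 * r ^ j) * (K2 * cmod z * r ^ (3 * (j + 1)))"
      unfolding norm_mult using even[of "j + 1"] odd[of j] n K1 r0 by (intro mult_mono) auto
    also have "\<dots> = (K1 * K2 * cmod z) * (r ^ j * r ^ (3 * (j + 1)))" by simp
    also have "r ^ j * r ^ (3 * (j + 1)) = r ^ (4 * j + 3)" by (simp flip: power_add)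
    also have "(K1 * K2 * cmod z) * r ^ (4 * j + 3) \<le> (K1 * K2 * cmod z) * r ^ (2 * n)"
      using K1 K2 r0 r1 by (intro mult_left_mono power_decreasing) (auto simp: n)
    finally show ?thesis .
  qed
  then show ?thesis by blast
qed

lemma jacobi_green_boundary:
  "(\<lambda>M. jacobi_green r n z M * jacobi_green r n z (Suc M) / of_real r ^ Suc M) \<longlonglongrightarrow> 0"
proof -
  obtain K where K: "\<And>M. cmod (jacobi_min r M z * jacobi_min r (Suc M) z) \<le> K * r ^ (2 * M)"
    using jacobi_min_bound by blast
  let ?c = "(cmod (jacobi_pol r n z))\<^sup>2 * K / r"
  show ?thesis
  proof (rule Lim_null_comparison)
    show "(\<lambda>M. ?c * r ^ M) \<longlonglongrightarrow> 0"
      using r0 r1 by (intro tendsto_mult_right_zero LIMSEQ_realpow_zero) auto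
    have "norm (jacobi_green r n z M * jacobi_green r n z (Suc M) / of_real r ^ Suc M) \<le> ?c * r ^ M"
      if "n \<le> M" for M
    proof -
      have "jacobi_green r n z M * jacobi_green r n z (Suc M)
          = (jacobi_pol r n z)\<^sup>2 * (jacobi_min r M z * jacobi_min r (Suc M) z)"
        using that by (simp add: jacobi_green_def min_absorb2 max_absorb1 power2_eq_square)
      then have "norm (jacobi_green r n z M * jacobi_green r n z (Suc M) / of_real r ^ Suc M)
          = (cmod (jacobi_pol r n z))\<^sup>2 * cmod (jacobi_min r M z * jacobi_min r (Suc M) z) / r ^ Suc M"
        using r0 by (simp add: norm_mult norm_divide norm_power)
      also have "\<dots> \<le> (cmod (jacobi_pol r n z))\<^sup>2 * (K * r ^ (2 * M)) / r ^ Suc M"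
        using r0 by (intro divide_right_mono mult_left_mono K) auto
      also have "\<dots> = ?c * r ^ M"
        using r0 by (simp add: field_simps mult_2 mult_2_right power_add)
      finally show ?thesis .
    qed
    then show "\<forall>\<^sub>F M in sequentially.
        norm (jacobi_green r n z M * jacobi_green r n z (Suc M) / of_real r ^ Suc M) \<le> ?c * r ^ M"
      by (rule eventually_sequentiallyI)
  qed
qed

text \<open>
  After division by \<open>qcos z\<close> this says that the entries of the resolvent are at most \<open>1 / \<bar>Im z\<bar>\<close>. The bound for the
  diagonal entry comes first and controls the others.
\<close>

lemma jacobi_green_le:
  assumes "Im z \<noteq> 0"
  shows "cmod (jacobi_green r n z m) * \<bar>Im z\<bar> \<le> cmod (qcos (r\<^sup>2) z)"
proof -
  let ?g = "jacobi_green r n z" and ?C = "cmod (qcos (r\<^sup>2) z)" and ?y = "\<bar>Im z\<bar>"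
  have y: "?y > 0" using assms by simp
  have b: "?y * (cmod (?g m))\<^sup>2 \<le> cmod (?g n) * ?C" for m
  proof -
    have "?y * (cmod (?g m))\<^sup>2 \<le> \<bar>Im (cnj (?g n) * qcos (r\<^sup>2) z)\<bar>"
      by (rule jacobi_eq_bound(1)[OF r0 jacobi_green_eq jacobi_green_boundary])
    also have "\<dots> \<le> cmod (?g n) * ?C"
      using abs_Im_le_cmod[of "cnj (?g n) * qcos (r\<^sup>2) z"] by (simp add: norm_mult)
    finally show ?thesis .
  qed
  have gn: "?y * cmod (?g n) \<le> ?C"
  proof (cases "?g n = 0")
    case False
    then show ?thesis using b[of n] by (simp add: power2_eq_square)
  qed simp
  have "(cmod (?g m) * ?y)\<^sup>2 = ?y * (?y * (cmod (?g m))\<^sup>2)"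
    by (simp add: power2_eq_square)
  also have "\<dots> \<le> ?y * (cmod (?g n) * ?C)"
    using b[of m] y by (intro mult_left_mono) auto
  also have "\<dots> = (?y * cmod (?g n)) * ?C"
    by simp
  also have "\<dots> \<le> ?C * ?C"
    using gn by (intro mult_right_mono) auto
  finally have "(cmod (?g m) * ?y)\<^sup>2 \<le> ?C\<^sup>2"
    by (simp add: power2_eq_square)
  then show ?thesis by (rule power2_le_imp_le) simp
qed

text \<open>
  At a zero of the q-cosine two consecutive entries (of index \<open>-1\<close> and \<open>0\<close>) would vanish, hence all of them; but the entries of
  odd index are nonzero multiples of values of the q-cosine at points that tend to \<open>0\<close>, where its value is \<open>1\<close>.
\<close>

lemma jacobi_min_0_nonzero:
  assumes "qcos (r\<^sup>2) z = 0"
  shows "jacobi_min r 0 z \<noteq> 0"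
proof
  assume Y0: "jacobi_min r 0 z = 0"
  have Y: "jacobi_min r n z = 0" for n
  proof (induction n rule: induct_nat_012)
    case 0
    show ?case by (rule Y0)
  next
    case 1
    show ?case using jacobi_min_1[of z] Y0 assms by simp
  next
    case (ge2 n)
    then show ?case using jacobi_min_rec[of n z] by simp
  qed
  have "qcos_ser (r\<^sup>2) (of_real (r ^ 4) ^ Suc j * z\<^sup>2) = 0" for j
  proof -
    have "4 * Suc j = 2 * (2 * j + 1 + 1)" by simp
    then have "complex_of_real (r ^ 4) ^ Suc j = of_real r ^ (2 * (2 * j + 1 + 1))"
      by (simp only: of_real_power power_mult[symmetric])
    then show ?thesis
      using Y[of "2 * j + 1"] r0 by (simp add: jacobi_min_def)
  qed
  moreover have "(\<lambda>j. qcos_ser (r\<^sup>2) (of_real (r ^ 4) ^ Suc j * z\<^sup>2)) \<longlonglongrightarrow> qcos_ser (r\<^sup>2) 0"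
  proof (rule isCont_tendsto_compose[where g = "qcos_ser (r\<^sup>2)" and l = 0])
    show "isCont (qcos_ser (r\<^sup>2)) 0"
      using holomorphic_on_imp_continuous_on[OF qcos_ser_holomorphic[OF r_square_bounds, of UNIV]]
      by (simp add: continuous_on_eq_continuous_at)
    have "r ^ 4 < 1" using r0 r1 by (simp add: power_less_one_iff)
    then have "(\<lambda>j. complex_of_real (r ^ 4) ^ j) \<longlonglongrightarrow> 0"
      using r0 by (intro LIMSEQ_power_zero) (simp add: norm_power)
    then show "(\<lambda>j. of_real (r ^ 4) ^ Suc j * z\<^sup>2) \<longlonglongrightarrow> (0 :: complex)"
      by (intro tendsto_mult_left_zero LIMSEQ_Suc)
  qed
  ultimately show False
    using qcos_ser_0[OF r_square_bounds] by (simp add: LIMSEQ_const_iff)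
qed

lemma qcos_zero_real:
  assumes "qcos (r\<^sup>2) z = 0"
  shows "Im z = 0"
proof (rule ccontr)
  assume "Im z \<noteq> 0"
  then show False
    using jacobi_green_le[of z 0 0] jacobi_min_0_nonzero[OF assms] assms
    by (simp add: jacobi_green_def mult_le_0_iff)
qed

section \<open>Reality and simplicity of the zeros\<close>

lemma qcos_holomorphic: "qcos (r\<^sup>2) holomorphic_on A"
proof -
  have "(qcos_ser (r\<^sup>2) \<circ> (\<lambda>z. z\<^sup>2)) holomorphic_on A"
    by (intro holomorphic_on_compose holomorphic_intros qcos_ser_holomorphic[OF r_square_bounds])
  then show ?thesis
    by (simp add: o_def qcos_eq_qcos_ser[abs_def])
qed

lemma qcos_DERIV: "(qcos (r\<^sup>2) has_field_derivative deriv (qcos (r\<^sup>2)) z) (at z)"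
  using holomorphic_derivI[OF qcos_holomorphic open_UNIV, of z] by simp

lemma qcos_cnj: "qcos (r\<^sup>2) (cnj z) = cnj (qcos (r\<^sup>2) z)"
  by (simp add: qcos_eq_qcos_ser flip: qcos_ser_cnj[OF r_square_bounds])

lemma deriv_qcos_real: "Im (deriv (qcos (r\<^sup>2)) (of_real x)) = 0"
proof -
  let ?h = "\<lambda>N. complex_of_real (inverse (real (Suc N)))"
  let ?q = "\<lambda>N. (qcos (r\<^sup>2) (of_real x + ?h N) - qcos (r\<^sup>2) (of_real x)) / ?h N"
  have real: "Im (qcos (r\<^sup>2) (of_real t)) = 0" for t
    using qcos_cnj[of "of_real t"] by (simp add: complex_eq_iff)
  have "Im (?q N) = 0" for N
    unfolding of_real_add[symmetric] Im_divide_of_real minus_complex.sel real by simp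
  moreover have "(\<lambda>N. Im (?q N)) \<longlonglongrightarrow> Im (deriv (qcos (r\<^sup>2)) (of_real x))"
  proof (intro tendsto_Im DERIV_seq_quotient[OF qcos_DERIV])
    show "?h \<longlonglongrightarrow> 0"
      using tendsto_of_real[OF LIMSEQ_inverse_real_of_nat] by (simp only: of_real_0)
  qed (simp only: of_real_eq_0_iff, simp)
  ultimately show ?thesis by (simp add: LIMSEQ_const_iff)
qed

lemma jacobi_min_real: "Im (jacobi_min r n (of_real x)) = 0"
  using jacobi_min_cnj[of n "of_real x"] by (simp add: complex_eq_iff)

text \<open>
  Approach the zero vertically, along \<open>x + \<i> \<epsilon>\<close>, in the energy inequality
  \<open>\<epsilon> * \<bar>Y\<bar>\<^sup>2 \<le> - Im (cnj Y * qcos)\<close> for \<open>Y = jacobi_min r 0\<close>, and divide by \<open>\<epsilon>\<close>.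
  In the limit the quotient \<open>qcos / (\<i> \<epsilon>)\<close> becomes the derivative. As \<open>Y\<close> does not vanish at the zero, this single
  inequality yields both that the zero is simple and that its weight is positive.
\<close>

lemma qcos_zero_slope:
  assumes "qcos (r\<^sup>2) (of_real x) = 0"
  shows "(cmod (jacobi_min r 0 (of_real x)))\<^sup>2
           \<le> - Re (cnj (jacobi_min r 0 (of_real x)) * deriv (qcos (r\<^sup>2)) (of_real x))"
proof -
  let ?h = "\<lambda>N. complex_of_real (inverse (real (Suc N))) * \<i>"
  let ?z = "\<lambda>N. of_real x + ?h N"
  let ?Y = "\<lambda>N. jacobi_min r 0 (?z N)"
  let ?q = "\<lambda>N. (qcos (r\<^sup>2) (?z N) - qcos (r\<^sup>2) (of_real x)) / ?h N"
  have h: "?h \<longlonglongrightarrow> 0"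
    using tendsto_mult_left_zero[OF tendsto_of_real[OF LIMSEQ_inverse_real_of_nat, unfolded of_real_0], of \<i>] .
  then have z: "?z \<longlonglongrightarrow> of_real x"
    using tendsto_add[OF tendsto_const[of "of_real x"] h] by simp
  have "isCont (jacobi_min r 0) (of_real x)"
    using holomorphic_on_imp_continuous_on[OF jacobi_min_holomorphic[of 0 UNIV]]
    by (simp add: continuous_on_eq_continuous_at)
  then have Y: "?Y \<longlonglongrightarrow> jacobi_min r 0 (of_real x)"
    using z by (rule isCont_tendsto_compose)
  have q: "?q \<longlonglongrightarrow> deriv (qcos (r\<^sup>2)) (of_real x)"
    by (rule DERIV_seq_quotient[OF qcos_DERIV h])
      (simp only: mult_eq_0_iff of_real_eq_0_iff complex_i_not_zero, simp)
  show ?thesis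
  proof (rule LIMSEQ_le)
    show "(\<lambda>N. (cmod (?Y N))\<^sup>2) \<longlonglongrightarrow> (cmod (jacobi_min r 0 (of_real x)))\<^sup>2"
      by (intro tendsto_intros Y)
    show "(\<lambda>N. - Re (cnj (?Y N) * ?q N)) \<longlonglongrightarrow>
        - Re (cnj (jacobi_min r 0 (of_real x)) * deriv (qcos (r\<^sup>2)) (of_real x))"
      by (intro tendsto_intros Y q)
    have "(cmod (?Y N))\<^sup>2 \<le> - Re (cnj (?Y N) * ?q N)" for N
    proof -
      let ?e = "inverse (real (Suc N))"
      have e: "?e > 0" by simp
      have "Im (of_real x + of_real a * \<i>) = a" for a by simp
      then have Im: "Im (?z N) = ?e" .
      have g: "jacobi_green r 0 (?z N) 0 = ?Y N"
        by (simp add: jacobi_green_def)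
      note b = jacobi_eq_bound[OF r0 jacobi_green_eq jacobi_green_boundary,
          where z = "?z N" and n = 0, unfolded g Im]
      have "?e * (cmod (?Y N))\<^sup>2 \<le> - Im (cnj (?Y N) * qcos (r\<^sup>2) (?z N))"
        using b(1)[where m = 0, unfolded g] b(2)[OF e] e by linarith
      also have "qcos (r\<^sup>2) (?z N) = of_real ?e * (\<i> * ?q N)"
        using assms by simp
      also have "- Im (cnj (?Y N) * (of_real ?e * (\<i> * ?q N))) = ?e * - Re (cnj (?Y N) * ?q N)"
      proof -
        have "cnj (?Y N) * (of_real ?e * (\<i> * ?q N)) = of_real ?e * (\<i> * (cnj (?Y N) * ?q N))"
          by (simp only: mult_ac)
        moreover have "Im (of_real a * (\<i> * w)) = a * Re w" for a w by simp
        ultimately show ?thesis by (simp only: mult_minus_right)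
      qed
      finally show ?thesis
        using e by (simp only: mult_le_cancel_left_pos)
    qed
    then show "\<exists>N. \<forall>n\<ge>N. (cmod (?Y n))\<^sup>2 \<le> - Re (cnj (?Y n) * ?q n)"
      by blast
  qed
qed

lemma
  assumes "qcos (r\<^sup>2) (of_real x) = 0"
  shows deriv_qcos_nonzero: "deriv (qcos (r\<^sup>2)) (of_real x) \<noteq> 0"
    and spectral_weight_nonneg: "0 \<le> spectral_weight r x"
    and of_real_spectral_weight: "of_real (spectral_weight r x)
          = - (jacobi_min r 0 (of_real x) / deriv (qcos (r\<^sup>2)) (of_real x))"
proof -
  define y where "y = Re (jacobi_min r 0 (of_real x))"
  define d where "d = Re (deriv (qcos (r\<^sup>2)) (of_real x))"
  have Y: "jacobi_min r 0 (of_real x) = of_real y" and D: "deriv (qcos (r\<^sup>2)) (of_real x) = of_real d"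
    using jacobi_min_real[of 0 x] deriv_qcos_real[of x] by (simp_all add: y_def d_def complex_eq_iff)
  have y: "y \<noteq> 0"
    using jacobi_min_0_nonzero[OF assms] by (simp add: Y)
  have s: "y\<^sup>2 \<le> - (y * d)"
    using qcos_zero_slope[OF assms] unfolding Y D by simp
  moreover have "0 < y\<^sup>2"
    using y by simp
  ultimately have yd: "y * d < 0" by linarith
  then have "d \<noteq> 0" by auto
  then show "deriv (qcos (r\<^sup>2)) (of_real x) \<noteq> 0" by (simp add: D)
  have w: "spectral_weight r x = - (y / d)"
    by (simp add: spectral_weight_def Y D)
  show "0 \<le> spectral_weight r x"
    using yd unfolding w by (simp add: divide_le_0_iff mult_less_0_iff) linarith
  show "of_real (spectral_weight r x)
          = - (jacobi_min r 0 (of_real x) / deriv (qcos (r\<^sup>2)) (of_real x))"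
    unfolding w Y D by simp
qed

lemma jacobi_min_at_zero:
  assumes "qcos (r\<^sup>2) z = 0"
  shows "jacobi_min r n z = jacobi_pol r n z * jacobi_min r 0 z"
proof (induction n rule: induct_nat_012)
  case 1
  show ?case using jacobi_min_1[of z] assms by simp
next
  case (ge2 n)
  then show ?case
    by (simp add: jacobi_min_rec[of n z, simplified] algebra_simps)
qed simp

section \<open>Residues of the Green function\<close>

lemma jacobi_green_at_zero:
  assumes "qcos (r\<^sup>2) z = 0"
  shows "jacobi_green r n z m = jacobi_pol r m z * jacobi_pol r n z * jacobi_min r 0 z"
  unfolding jacobi_green_def jacobi_min_at_zero[OF assms, of "max m n"]
  by (cases "m \<le> n") (simp_all add: min_def max_def)

lemma jacobi_green_holomorphic: "(\<lambda>z. jacobi_green r n z m) holomorphic_on A"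
  unfolding jacobi_green_def
  by (intro holomorphic_intros jacobi_pol_holomorphic jacobi_min_holomorphic)

text \<open>
  Row \<open>m\<close> of \<open>(J - z) g = qcos z * e\<^sub>n\<close> expresses \<open>z * g m\<close> plus the source term through the neighbours of
  \<open>g m\<close>, which \<open>jacobi_green_le\<close> bounds. For the resolvent entries \<open>h = g / qcos\<close> it says that
  \<open>z * h m\<close> is \<open>- \<delta>\<^bsub>mn\<^esub>\<close> up to an error of order \<open>1 / \<bar>Im z\<bar>\<close>.
\<close>

lemma jacobi_green_asymp:
  "\<exists>K. \<forall>z. Im z \<noteq> 0 \<longrightarrow>
     cmod (z * jacobi_green r n z m + (if n = m then qcos (r\<^sup>2) z else 0)) * \<bar>Im z\<bar>
       \<le> K * cmod (qcos (r\<^sup>2) z)"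
proof (cases m)
  case 0
  have "cmod (z * jacobi_green r n z m + (if n = m then qcos (r\<^sup>2) z else 0)) * \<bar>Im z\<bar>
       \<le> (1 / r) * cmod (qcos (r\<^sup>2) z)" if "Im z \<noteq> 0" for z
  proof -
    have "jacobi_green r n z 1 = of_real r * (z * jacobi_green r n z 0 + (if n = 0 then qcos (r\<^sup>2) z else 0))"
      using jacobi_green_eq[of z n] by (simp add: jacobi_eq_def algebra_simps)
    then have "cmod (z * jacobi_green r n z 0 + (if n = 0 then qcos (r\<^sup>2) z else 0))
        = cmod (jacobi_green r n z 1) / r"
      using r0 by (simp add: norm_mult)
    then show ?thesis
      using jacobi_green_le[OF that, of n 1] r0 by (simp add: 0 divide_right_mono)
  qed
  then show ?thesis by blast
next
  case (Suc k)
  have "cmod (z * jacobi_green r n z m + (if n = m then qcos (r\<^sup>2) z else 0)) * \<bar>Im z\<bar>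
       \<le> ((1 + r) / r ^ (k + 2)) * cmod (qcos (r\<^sup>2) z)" if "Im z \<noteq> 0" for z
  proof -
    let ?g = "jacobi_green r n z"
    have "?g (k + 2) + of_real r * ?g k
        = of_real r ^ (k + 2) * (z * ?g (k + 1) + (if n = k + 1 then qcos (r\<^sup>2) z else 0))"
      using jacobi_green_eq[of z n] unfolding jacobi_eq_def
      by (auto simp: algebra_simps)
    then have "cmod (?g (k + 2) + of_real r * ?g k)
        = r ^ (k + 2) * cmod (z * ?g (k + 1) + (if n = k + 1 then qcos (r\<^sup>2) z else 0))"
      using r0 by (simp only: norm_mult norm_power norm_of_real abs_of_pos)
    moreover have "cmod (?g (k + 2) + of_real r * ?g k) \<le> cmod (?g (k + 2)) + r * cmod (?g k)"
      using norm_triangle_ineq[of "?g (k + 2)" "of_real r * ?g k"] r0 by (simp add: norm_mult)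
    moreover have "r ^ (k + 2) > 0" using r0 by simp
    ultimately have "cmod (z * ?g (k + 1) + (if n = k + 1 then qcos (r\<^sup>2) z else 0))
        \<le> (cmod (?g (k + 2)) + r * cmod (?g k)) / r ^ (k + 2)"
      by (simp only: pos_le_divide_eq mult.commute)
    then have "cmod (z * ?g (k + 1) + (if n = k + 1 then qcos (r\<^sup>2) z else 0)) * \<bar>Im z\<bar>
        \<le> (cmod (?g (k + 2)) + r * cmod (?g k)) / r ^ (k + 2) * \<bar>Im z\<bar>"
      by (rule mult_right_mono) simp
    also have "\<dots> = (cmod (?g (k + 2)) * \<bar>Im z\<bar> + r * (cmod (?g k) * \<bar>Im z\<bar>)) / r ^ (k + 2)"
      by (simp add: algebra_simps)
    also have "\<dots> \<le> (cmod (qcos (r\<^sup>2) z) + r * cmod (qcos (r\<^sup>2) z)) / r ^ (k + 2)"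
      using r0 by (intro divide_right_mono add_mono mult_left_mono jacobi_green_le[OF that]) auto
    finally show ?thesis
      by (simp add: Suc algebra_simps)
  qed
  then show ?thesis by blast
qed

lemma qcos_0: "qcos (r\<^sup>2) 0 = 1"
  by (simp add: qcos_eq_qcos_ser qcos_ser_0[OF r_square_bounds])

lemma finite_qcos_zeros: "finite {z. cmod z \<le> R \<and> qcos (r\<^sup>2) z = 0}"
proof (cases "\<exists>z. qcos (r\<^sup>2) z = 0")
  case True
  \<comment> \<open>The only constant value possible is \<open>qcos 0 = 1\<close>, which a zero excludes.\<close>
  have "\<not> qcos (r\<^sup>2) constant_on UNIV"
    using True qcos_0 unfolding constant_on_def by force
  then have "finite {z \<in> cball 0 R. qcos (r\<^sup>2) z = 0}"
    by (intro holomorphic_compact_finite_zeros[OF qcos_holomorphic open_UNIV]) auto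
  then show ?thesis by simp
next
  case False
  then have "{z. cmod z \<le> R \<and> qcos (r\<^sup>2) z = 0} = {}" by auto
  then show ?thesis by (simp only: finite.emptyI)
qed

text \<open>
  The sum ranges over real \<open>x\<close> because the q-cosine has no other zeros, and each zero gives a single quotient because it is simple.
\<close>

lemma qcos_quotient_contour_integral:
  assumes R: "R > 0" and avoid: "\<And>z. cmod z = R \<Longrightarrow> qcos (r\<^sup>2) z \<noteq> 0"
    and N: "N holomorphic_on UNIV"
  shows "((\<lambda>z. N z / qcos (r\<^sup>2) z) has_contour_integral
           2 * pi * \<i> * (\<Sum>x | qcos (r\<^sup>2) (of_real x) = 0 \<and> \<bar>x\<bar> < R.
             N (of_real x) / deriv (qcos (r\<^sup>2)) (of_real x)))
         (circlepath 0 R)"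
proof -
  let ?C = "qcos (r\<^sup>2)" and ?\<gamma> = "circlepath 0 R"
  let ?F = "\<lambda>z. N z / ?C z"
  define S where "S = ball (0::complex) (R + 1)"
  define pts where "pts = {z. z \<in> S \<and> ?C z = 0}"
  have fin: "finite pts"
    by (rule finite_subset[OF _ finite_qcos_zeros[of "R + 1"]]) (auto simp: pts_def S_def)
  have holo: "?F holomorphic_on S - pts"
    using N qcos_holomorphic by (intro holomorphic_on_divide) (auto simp: pts_def intro: holomorphic_on_subset)
  have path: "path_image ?\<gamma> \<subseteq> S - pts"
    using R avoid by (auto simp: path_image_circlepath S_def pts_def sphere_def)
  have outside: "winding_number ?\<gamma> z = 0" if "cmod z > R" for z
    by (rule winding_number_zero_outside[where s = "cball 0 R"])
      (use R that in \<open>auto simp: path_image_circlepath sphere_def\<close>)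
  have inside: "winding_number ?\<gamma> z = 1" if "cmod z < R" for z
    using winding_number_circlepath[of z 0 R] that by simp
  have int: "contour_integral ?\<gamma> ?F = 2 * pi * \<i> * (\<Sum>p\<in>pts. winding_number ?\<gamma> p * residue ?F p)"
    by (rule Residue_theorem[OF _ _ fin holo _ _ path]) (auto simp: S_def intro!: outside)
  have "(\<Sum>p\<in>pts. winding_number ?\<gamma> p * residue ?F p)
      = (\<Sum>p | ?C p = 0 \<and> cmod p < R. N p / deriv ?C p)"
  proof (rule sum.mono_neutral_cong_right[OF fin])
    show "{p. ?C p = 0 \<and> cmod p < R} \<subseteq> pts"
      by (auto simp: pts_def S_def)
    show "\<forall>p\<in>pts - {p. ?C p = 0 \<and> cmod p < R}. winding_number ?\<gamma> p * residue ?F p = 0"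
    proof
      fix p assume "p \<in> pts - {p. ?C p = 0 \<and> cmod p < R}"
      then have "?C p = 0" "\<not> cmod p < R" by (auto simp: pts_def)
      with avoid[of p] have "cmod p > R" by force
      then show "winding_number ?\<gamma> p * residue ?F p = 0" by (simp add: outside)
    qed
  next
    fix p assume "p \<in> {p. ?C p = 0 \<and> cmod p < R}"
    then have p: "?C p = 0" "cmod p < R" by auto
    have "Im p = 0" by (rule qcos_zero_real[OF p(1)])
    then have pr: "p = of_real (Re p)" by (simp add: complex_eq_iff)
    have "residue ?F p = N p / deriv ?C p"
    proof (rule residue_quotient_simple_zero)
      show "open (S - (pts - {p}))"
        using fin by (auto simp: S_def intro!: open_Diff finite_imp_closed)
      show "p \<in> S - (pts - {p})" using p by (auto simp: S_def)
      have "S - (pts - {p}) - {p} \<subseteq> S - pts" by auto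
      then show "?F holomorphic_on S - (pts - {p}) - {p}"
        by (rule holomorphic_on_subset[OF holo])
      show "isCont N p"
        using holomorphic_on_imp_continuous_on[OF N] by (simp add: continuous_on_eq_continuous_at)
      show "deriv ?C p \<noteq> 0"
        using deriv_qcos_nonzero[of "Re p"] p(1) pr by simp
    qed (use p qcos_DERIV in auto)
    then show "winding_number ?\<gamma> p * residue ?F p = N p / deriv ?C p"
      using p by (simp add: inside)
  qed
  also have "{p. ?C p = 0 \<and> cmod p < R} = of_real ` {x. ?C (of_real x) = 0 \<and> \<bar>x\<bar> < R}"
  proof -
    have "\<exists>x. p = of_real x" if "?C p = 0" for p
      using qcos_zero_real[OF that] by (intro exI[of _ "Re p"]) (simp add: complex_eq_iff)
    then show ?thesis by fastforce
  qed
  also have "(\<Sum>p\<in>of_real ` {x. ?C (of_real x) = 0 \<and> \<bar>x\<bar> < R}. N p / deriv ?C p)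
      = (\<Sum>x | ?C (of_real x) = 0 \<and> \<bar>x\<bar> < R. N (of_real x) / deriv ?C (of_real x))"
    by (subst sum.reindex) (auto simp: inj_on_def)
  finally have "contour_integral ?\<gamma> ?F = 2 * pi * \<i> *
      (\<Sum>x | ?C (of_real x) = 0 \<and> \<bar>x\<bar> < R. N (of_real x) / deriv ?C (of_real x))"
    using int by simp
  moreover have "?F contour_integrable_on ?\<gamma>"
    using path holomorphic_on_imp_continuous_on[OF holo]
    by (intro contour_integrable_continuous_circlepath) (rule continuous_on_subset)
  ultimately show ?thesis
    using has_contour_integral_integral by metis
qed

text \<open>
  Integrate \<open>(h m + \<delta>\<^bsub>mn\<^esub> / z) * (1 - z\<^sup>2 / R\<^sup>2)\<close> over the circle of radius \<open>R\<close>, where \<open>h\<close> is the Green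
  function divided by the q-cosine. The residue of \<open>h m\<close> at a zero \<open>x\<close> is minus the weight times \<open>P\<^sub>m P\<^sub>n\<close>, and
  the pole at \<open>0\<close> contributes \<open>\<delta>\<^bsub>mn\<^esub>\<close>. On the circle the last factor has modulus \<open>2 \<bar>Im z\<bar> / R\<close>, which cancels
  the singularity \<open>1 / \<bar>Im z\<bar>\<close> of the resolvent bound at the real axis. So the integrand is \<open>O(1 / R\<^sup>2)\<close> uniformly
  on the circle; the resolvent bound takes the place of a lower bound for \<open>qcos\<close>.
\<close>

lemma riesz_mean_estimate:
  "\<exists>K. \<forall>R>0. (\<forall>z. cmod z = R \<longrightarrow> qcos (r\<^sup>2) z \<noteq> 0) \<longrightarrow>
     \<bar>(\<Sum>x | qcos (r\<^sup>2) (of_real x) = 0 \<and> \<bar>x\<bar> < R.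
         spectral_weight r x * poly (Pq (r\<^sup>2) m) (r * x) * poly (Pq (r\<^sup>2) n) (r * x)
           * (1 - x\<^sup>2 / R\<^sup>2)) - (if m = n then 1 else 0)\<bar> \<le> K / R"
proof -
  let ?C = "qcos (r\<^sup>2)" and ?g = "\<lambda>z. jacobi_green r n z m"
  let ?\<delta> = "if m = n then 1 else 0 :: complex"
  obtain K where K: "\<And>z. Im z \<noteq> 0 \<Longrightarrow>
      cmod (z * ?g z + (if n = m then ?C z else 0)) * \<bar>Im z\<bar> \<le> K * cmod (?C z)"
    using jacobi_green_asymp[of n m] by blast
  have "\<bar>(\<Sum>x | ?C (of_real x) = 0 \<and> \<bar>x\<bar> < R.
         spectral_weight r x * poly (Pq (r\<^sup>2) m) (r * x) * poly (Pq (r\<^sup>2) n) (r * x)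
           * (1 - x\<^sup>2 / R\<^sup>2)) - (if m = n then 1 else 0)\<bar> \<le> (2 * \<bar>K\<bar>) / R"
    if R: "R > 0" and avoid: "\<And>z. cmod z = R \<Longrightarrow> ?C z \<noteq> 0" for R
  proof -
    define \<phi> where "\<phi> z = 1 - z\<^sup>2 / (of_real R)\<^sup>2" for z :: complex
    define Z where "Z = {x. ?C (of_real x) = 0 \<and> \<bar>x\<bar> < R}"
    define s where "s = (\<Sum>x\<in>Z. spectral_weight r x * poly (Pq (r\<^sup>2) m) (r * x)
        * poly (Pq (r\<^sup>2) n) (r * x) * (1 - x\<^sup>2 / R\<^sup>2))"
    have hol\<phi>: "\<phi> holomorphic_on A" for A
      unfolding \<phi>_def using R by (intro holomorphic_intros) auto
    have summand: "?g (of_real x) * \<phi> (of_real x) / deriv ?C (of_real x)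
        = - of_real (spectral_weight r x * poly (Pq (r\<^sup>2) m) (r * x)
              * poly (Pq (r\<^sup>2) n) (r * x) * (1 - x\<^sup>2 / R\<^sup>2))" if "x \<in> Z" for x
    proof -
      have z: "?C (of_real x) = 0" using that by (simp add: Z_def)
      have "\<phi> (of_real x) = of_real (1 - x\<^sup>2 / R\<^sup>2)" by (simp add: \<phi>_def)
      then show ?thesis
        unfolding jacobi_green_at_zero[OF z] of_real_mult of_real_spectral_weight[OF z]
        by (simp add: jacobi_pol_of_real[OF r0])
    qed
    have "((\<lambda>z. ?g z * \<phi> z / ?C z) has_contour_integral
        2 * pi * \<i> * (\<Sum>x\<in>Z. ?g (of_real x) * \<phi> (of_real x) / deriv ?C (of_real x))) (circlepath 0 R)"
      unfolding Z_def
      by (rule qcos_quotient_contour_integral[OF R avoid])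
        (auto intro!: holomorphic_intros jacobi_green_holomorphic hol\<phi>)
    moreover have "(\<Sum>x\<in>Z. ?g (of_real x) * \<phi> (of_real x) / deriv ?C (of_real x)) = - of_real s"
      unfolding s_def of_real_sum sum_negf[symmetric] by (intro sum.cong refl summand)
    ultimately have I1: "((\<lambda>z. ?g z * \<phi> z / ?C z) has_contour_integral 2 * pi * \<i> * - of_real s) (circlepath 0 R)"
      by simp
    have "((\<lambda>z. \<phi> z / (z - 0)) has_contour_integral 2 * of_real pi * \<i> * \<phi> 0) (circlepath 0 R)"
      using R by (intro Cauchy_integral_circlepath_simple hol\<phi>) simp
    then have "((\<lambda>z. ?\<delta> * (\<phi> z / (z - 0))) has_contour_integral ?\<delta> * (2 * of_real pi * \<i> * \<phi> 0)) (circlepath 0 R)"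
      by (rule has_contour_integral_lmul)
    from has_contour_integral_add[OF I1 this]
    have I: "((\<lambda>z. ?g z * \<phi> z / ?C z + ?\<delta> * (\<phi> z / (z - 0))) has_contour_integral
        2 * pi * \<i> * (?\<delta> - of_real s)) (circlepath 0 R)"
      by (simp add: \<phi>_def algebra_simps)
    have bound: "cmod (?g z * \<phi> z / ?C z + ?\<delta> * (\<phi> z / (z - 0))) \<le> 2 * \<bar>K\<bar> / R\<^sup>2"
      if z: "cmod (z - 0) = R" for z
    proof -
      have z0: "z \<noteq> 0" and C: "?C z \<noteq> 0" and zR: "cmod z = R" using z R avoid by auto
      \<comment> \<open>On the circle \<open>R\<^sup>2 - z\<^sup>2 = z (cnj z - z)\<close>, which is the origin of the factor \<open>Im z\<close>.\<close>
      have "(of_real R)\<^sup>2 = z * cnj z" using cmod_square[of z] zR by simp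
      then have "\<phi> z = (cnj z - z) / cnj z"
        using z0 by (simp add: \<phi>_def field_simps power2_eq_square)
      also have "cnj z - z = - (2 * \<i> * of_real (Im z))" by (simp add: complex_eq_iff)
      finally have \<phi>z: "cmod (\<phi> z) = 2 * \<bar>Im z\<bar> / R"
        by (simp add: norm_divide norm_mult zR)
      show ?thesis
      proof (cases "Im z = 0")
        case True
        then have "\<phi> z = 0" using \<phi>z by simp
        then show ?thesis by simp
      next
        case False
        have "?g z * \<phi> z / ?C z + ?\<delta> * (\<phi> z / (z - 0))
            = (z * ?g z + (if n = m then ?C z else 0)) * \<phi> z / (z * ?C z)"
          using z0 C by (simp add: field_simps)
        then have "cmod (?g z * \<phi> z / ?C z + ?\<delta> * (\<phi> z / (z - 0)))
            = (cmod (z * ?g z + (if n = m then ?C z else 0)) * \<bar>Im z\<bar>) * (2 / R) / (R * cmod (?C z))"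
          by (simp only: norm_divide norm_mult \<phi>z zR) simp
        also have "\<dots> \<le> (K * cmod (?C z)) * (2 / R) / (R * cmod (?C z))"
          using R by (intro divide_right_mono mult_right_mono K False) auto
        also have "\<dots> = 2 * K / R\<^sup>2"
          using C R by (simp add: field_simps power2_eq_square)
        also have "\<dots> \<le> 2 * \<bar>K\<bar> / R\<^sup>2"
          by (intro divide_right_mono) auto
        finally show ?thesis .
      qed
    qed
    have "cmod (2 * pi * \<i> * (?\<delta> - of_real s)) \<le> 2 * \<bar>K\<bar> / R\<^sup>2 * (2 * pi * R)"
      by (rule has_contour_integral_bound_circlepath[OF I _ R bound]) auto
    also have "\<dots> = 2 * pi * (2 * \<bar>K\<bar> / R)"
      using R by (simp add: power2_eq_square)
    finally have "2 * pi * cmod (?\<delta> - of_real s) \<le> 2 * pi * (2 * \<bar>K\<bar> / R)"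
      by (simp add: norm_mult)
    then have "cmod (?\<delta> - of_real s) \<le> 2 * \<bar>K\<bar> / R"
      using pi_gt_zero by (simp only: mult_le_cancel_left_pos)
    moreover have "?\<delta> - of_real s = - of_real (s - (if m = n then 1 else 0))"
      by simp
    ultimately have "\<bar>s - (if m = n then 1 else 0)\<bar> \<le> 2 * \<bar>K\<bar> / R"
      by (simp only: norm_minus_cancel norm_of_real)
    then show ?thesis by (simp add: s_def Z_def)
  qed
  then show ?thesis by blast
qed

section \<open>Completeness\<close>

lemma qcos_free_radii: "\<exists>R. filterlim R at_top sequentially \<and>
    (\<forall>N. 0 < R N \<and> (\<forall>z. cmod z = R N \<longrightarrow> qcos (r\<^sup>2) z \<noteq> 0))"
proof -
  have "\<exists>\<rho>. real N < \<rho> \<and> (\<forall>z. cmod z = \<rho> \<longrightarrow> qcos (r\<^sup>2) z \<noteq> 0)" for N :: nat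
  proof -
    let ?B = "cmod ` {z. cmod z \<le> real N + 1 \<and> qcos (r\<^sup>2) z = 0}"
    \<comment> \<open>Only finitely many moduli of zeros lie below \<open>N + 1\<close>, so some radius in this interval avoids them all.\<close>
    have "infinite ({real N<..<real N + 1} - ?B)"
      using finite_qcos_zeros by (intro Diff_infinite_finite) auto
    then obtain \<rho> where "\<rho> \<in> {real N<..<real N + 1} - ?B"
      using infinite_imp_nonempty by blast
    then show ?thesis by (intro exI[of _ \<rho>]) force
  qed
  then obtain R where R: "\<And>N. real N < R N" "\<And>N z. cmod z = R N \<Longrightarrow> qcos (r\<^sup>2) z \<noteq> 0"
    by metis
  have "filterlim R at_top sequentially"
    by (rule filterlim_at_top_mono[OF filterlim_real_sequentially]) (simp add: less_imp_le[OF R(1)])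
  moreover have "0 < R N" for N
    using R(1)[of N] by (rule order_le_less_trans[rotated]) simp
  ultimately show ?thesis using R(2) by blast
qed

text \<open>
  Polarization reduces the relation to the nonnegative terms \<open>w * (P\<^sub>m + \<epsilon> * P\<^sub>n)\<^sup>2\<close> with \<open>\<epsilon> = 1\<close> and
  \<open>\<epsilon> = -1\<close>, for which weighted partial sums determine the sum.
\<close>

lemma spectral_orthogonality:
  "((\<lambda>x. spectral_weight r x * poly (Pq (r\<^sup>2) m) (r * x) * poly (Pq (r\<^sup>2) n) (r * x))
      has_sum (if m = n then 1 else 0)) {x. qcos (r\<^sup>2) (of_real x) = 0}"
proof -
  define Z where "Z = {x::real. qcos (r\<^sup>2) (of_real x) = 0}"
  define p where "p n x = poly (Pq (r\<^sup>2) n) (r * x)" for n x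
  let ?w = "spectral_weight r"
  obtain R where R: "filterlim R at_top sequentially" "\<And>N. 0 < R N"
    "\<And>N z. cmod z = R N \<Longrightarrow> qcos (r\<^sup>2) z \<noteq> 0"
    using qcos_free_radii by blast
  define M where "M m n N = (\<Sum>x | x \<in> Z \<and> \<bar>x\<bar> < R N. ?w x * p m x * p n x * (1 - x\<^sup>2 / (R N)\<^sup>2))" for m n N
  have lim: "M m n \<longlonglongrightarrow> (if m = n then 1 else 0)" for m n
  proof -
    obtain K where K: "\<And>N. \<bar>M m n N - (if m = n then 1 else 0)\<bar> \<le> K / R N"
      using riesz_mean_estimate[of m n] R(2,3) unfolding M_def Z_def p_def mem_Collect_eq by blast
    have "(\<lambda>N. M m n N - (if m = n then 1 else 0)) \<longlonglongrightarrow> 0"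
    proof (rule Lim_null_comparison)
      show "(\<lambda>N. K / R N) \<longlonglongrightarrow> 0"
        by (intro tendsto_divide_0[OF tendsto_const] filterlim_at_top_imp_at_infinity R)
    qed (use K in auto)
    then show ?thesis by (simp add: LIM_zero_iff)
  qed
  have fin: "finite {x \<in> Z. \<bar>x\<bar> < T}" for T
  proof (rule finite_imageD)
    show "finite (complex_of_real ` {x \<in> Z. \<bar>x\<bar> < T})"
      by (rule finite_subset[OF _ finite_qcos_zeros[of T]]) (auto simp: Z_def)
  qed (auto simp: inj_on_def)
  have sq: "((\<lambda>x. ?w x * (p m x + \<epsilon> * p n x)\<^sup>2) has_sum
      (1 + 2 * \<epsilon> * (if m = n then 1 else 0) + \<epsilon>\<^sup>2)) Z" for \<epsilon>
  proof (rule nonneg_has_sum_riesz_means[OF _ fin R(1)])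
    show "0 \<le> ?w x * (p m x + \<epsilon> * p n x)\<^sup>2" if "x \<in> Z" for x
      using spectral_weight_nonneg[of x] that by (simp add: Z_def)
    have "(\<Sum>x | x \<in> Z \<and> \<bar>x\<bar> < R N. ?w x * (p m x + \<epsilon> * p n x)\<^sup>2 * (1 - x\<^sup>2 / (R N)\<^sup>2))
        = M m m N + 2 * \<epsilon> * M m n N + \<epsilon>\<^sup>2 * M n n N" for N
      unfolding M_def sum_distrib_left sum.distrib[symmetric]
      by (intro sum.cong refl) (simp add: power2_eq_square algebra_simps)
    moreover have "(\<lambda>N. M m m N + 2 * \<epsilon> * M m n N + \<epsilon>\<^sup>2 * M n n N) \<longlonglongrightarrow>
        1 + 2 * \<epsilon> * (if m = n then 1 else 0) + \<epsilon>\<^sup>2 * 1"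
      using lim[of m m] lim[of m n] lim[of n n] by (intro tendsto_intros) simp_all
    ultimately show "(\<lambda>N. \<Sum>x | x \<in> Z \<and> \<bar>x\<bar> < R N.
        ?w x * (p m x + \<epsilon> * p n x)\<^sup>2 * (1 - x\<^sup>2 / (R N)\<^sup>2)) \<longlonglongrightarrow>
        1 + 2 * \<epsilon> * (if m = n then 1 else 0) + \<epsilon>\<^sup>2"
      by simp
  qed
  have "((\<lambda>x. (1 / 4) * (?w x * (p m x + 1 * p n x)\<^sup>2) + (- 1 / 4) * (?w x * (p m x + (- 1) * p n x)\<^sup>2)) has_sum
      (1 / 4) * (1 + 2 * 1 * (if m = n then 1 else 0) + 1\<^sup>2)
        + (- 1 / 4) * (1 + 2 * (- 1) * (if m = n then 1 else 0) + (- 1)\<^sup>2)) Z"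
    by (intro has_sum_add has_sum_cmult_right sq)
  moreover have "(1 / 4) * (?w x * (p m x + 1 * p n x)\<^sup>2) + (- 1 / 4) * (?w x * (p m x + (- 1) * p n x)\<^sup>2)
      = ?w x * p m x * p n x" for x
    by (simp add: power2_eq_square algebra_simps)
  moreover have "(1 / 4) * (1 + 2 * 1 * (if m = n then 1 else 0) + 1\<^sup>2)
        + (- 1 / 4) * (1 + 2 * (- 1) * (if m = n then 1 else 0) + (- 1)\<^sup>2) = (if m = n then 1 else 0 :: real)"
    by simp
  ultimately show ?thesis
    by (simp only: Z_def p_def)
qed

end

section \<open>The orthogonality relation over the zeros\<close>

theorem proposition17:
  fixes q :: real and c :: "int \<Rightarrow> real" and m n :: nat
  assumes "0 < q" and "q < 1"
    and c_mono: "strict_mono_on {1..} c"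
    and c_zeros: "c ` {1..} = {x. 0 < x \<and> qcos q (of_real x) = 0}"
    and c_neg: "\<And>k. k \<ge> 1 \<Longrightarrow> c (- k) = - c k"
  defines "f \<equiv> \<lambda>k. qcos q (of_real (q * c k)) / (of_real (c k) * deriv (qcos q) (of_real (c k)))
              * of_real (poly (Pq q n) (q powr (1 / 2) * c k))
              * of_real (poly (Pq q m) (q powr (1 / 2) * c k))"
  shows "f summable_on (UNIV - {0}) \<and> - (\<Sum>\<^sub>\<infinity>k\<in>UNIV - {0}. f k) = (if m = n then 1 else 0)"
proof -
  define r where "r = sqrt q"
  have r0: "0 < r" and r1: "r < 1" and q: "q = r\<^sup>2"
    using assms(1,2) by (auto simp: r_def)
  define Z where "Z = {x::real. qcos (r\<^sup>2) (of_real x) = 0}"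
  have even: "qcos q (- z) = qcos q z" for z
    by (simp add: qcos_eq_qcos_ser)
  have pos: "c k > 0" "qcos q (of_real (c k)) = 0" if "k \<ge> 1" for k
    using c_zeros that by auto
  have neg: "c k = - c (- k)" if "k \<le> -1" for k
    using c_neg[of "- k"] that by simp
  have bij: "bij_betw c (UNIV - {0}) Z"
  proof (rule bij_betw_imageI)
    have sign: "0 < c k \<longleftrightarrow> k \<ge> 1" if "k \<noteq> 0" for k
    proof (cases "k \<ge> 1")
      case False
      then have k: "k \<le> -1" using that by simp
      then show ?thesis using neg[OF k] pos(1)[of "- k"] by simp
    qed (simp add: pos)
    have inj: "k = l" if "k \<ge> 1" "l \<ge> 1" "c k = c l" for k l
      using strict_mono_on_eqD[OF c_mono that(3)] that by simp
    show "inj_on c (UNIV - {0})"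
    proof (rule inj_onI)
      fix k l assume "k \<in> UNIV - {0}" "l \<in> UNIV - {0}" and kl: "c k = c l"
      then have k: "k \<noteq> 0" and l: "l \<noteq> 0" by auto
      show "k = l"
      proof (cases "k \<ge> 1")
        case True
        then have "l \<ge> 1" using sign[OF k] sign[OF l] kl by simp
        then show ?thesis using inj True kl by blast
      next
        case False
        then have "\<not> l \<ge> 1" using sign[OF k] sign[OF l] kl by simp
        then have "k \<le> -1" "l \<le> -1" using False k l by simp_all
        then show ?thesis using inj[of "- k" "- l"] neg[of k] neg[of l] kl by simp
      qed
    qed
    show "c ` (UNIV - {0}) = Z"
    proof (intro equalityI subsetI)
      fix x assume "x \<in> c ` (UNIV - {0})"
      then obtain k where k: "k \<noteq> 0" "x = c k" by auto
      show "x \<in> Z"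
      proof (cases "k \<ge> 1")
        case True
        then show ?thesis using pos(2)[OF True] k by (simp add: Z_def q)
      next
        case False
        then have k': "k \<le> -1" using k by simp
        then show ?thesis
          using pos(2)[of "- k"] k neg[OF k'] even[of "of_real (c (- k))"] by (simp add: Z_def q)
      qed
    next
      fix x assume "x \<in> Z"
      then have x: "qcos q (of_real x) = 0" by (simp add: Z_def q)
      then have "x \<noteq> 0" using qcos_0[OF r0 r1] q by auto
      then consider "x > 0" | "- x > 0" by linarith
      then show "x \<in> c ` (UNIV - {0})"
      proof cases
        case 1
        with x have "x \<in> c ` {1..}" using c_zeros by auto
        then show ?thesis by auto
      next
        case 2
        with x even[of "of_real x"] have "- x \<in> c ` {1..}" using c_zeros by auto
        then obtain k where "k \<ge> 1" "c k = - x" by auto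
        then have "x = c (- k)" "- k \<noteq> 0" using c_neg[of k] by auto
        then show ?thesis by blast
      qed
    qed
  qed
  let ?a = "\<lambda>x. spectral_weight r x * poly (Pq (r\<^sup>2) m) (r * x) * poly (Pq (r\<^sup>2) n) (r * x)"
  have f: "f k = - of_real (?a (c k))" if "k \<in> UNIV - {0}" for k
  proof -
    have "c k \<in> Z" using bij that by (auto simp: bij_betw_def)
    then have z: "qcos (r\<^sup>2) (of_real (c k)) = 0" by (simp add: Z_def)
    then have "c k \<noteq> 0" using qcos_0[OF r0 r1] by auto
    \<comment> \<open>At a zero the numerator \<open>qcos q (q z) - qcos q z\<close> of \<open>jacobi_min_0\<close> reduces to its first term.\<close>
    then have "jacobi_min r 0 (of_real (c k)) = qcos q (of_real (q * c k)) / of_real (c k)"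
      using jacobi_min_0[OF r0 r1, of "of_real (c k)"] z by (simp add: q field_simps)
    then have w: "of_real (spectral_weight r (c k))
        = - (qcos q (of_real (q * c k)) / (of_real (c k) * deriv (qcos q) (of_real (c k))))"
      unfolding of_real_spectral_weight[OF r0 r1 z] by (simp add: q)
    have "q powr (1 / 2) = r"
      using assms(1) by (simp add: r_def powr_half_sqrt)
    then show ?thesis
      unfolding f_def of_real_mult w by (simp add: q)
  qed
  have "(?a has_sum (if m = n then 1 else 0)) Z"
    unfolding Z_def by (rule spectral_orthogonality[OF r0 r1])
  then have "((\<lambda>k. ?a (c k)) has_sum (if m = n then 1 else 0)) (UNIV - {0})"
    by (rule iffD2[OF has_sum_reindex_bij_betw[OF bij]])
  then have "((\<lambda>k. - complex_of_real (?a (c k))) has_sum - of_real (if m = n then 1 else 0)) (UNIV - {0})"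
    by (intro has_sum_uminusI has_sum_of_real)
  then have "(f has_sum - of_real (if m = n then 1 else 0)) (UNIV - {0})"
    by (simp only: has_sum_cong[OF f])
  then show ?thesis
    by (auto simp: summable_on_def dest: infsumI)
qed

end
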